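(* Let $D>1$ be a square-free integer, $\mathcal{O}_D$ the ring of integers of $\mathbb{Q}(\sqrt D)\subset\mathbb{R}$, and $\varepsilon>1$ the fundamental unit of $\mathcal{O}_D$, assumed to satisfy $N(\varepsilon)=-1$. Let $q=D$ if $D\equiv1\bmod4$ and $q=4D$ otherwise, let $F_D(n)=\operatorname{Tr}_{\mathbb{Q}(\sqrt D)/\mathbb{Q}}(\varepsilon^n/\sqrt q)$, and $Z_D^{\textup{odd}}(s)=\sum_{n\ge1}F_D(2n-1)^{-s}$ for $\Re s>0$. Then for $s\in\mathbb{C}$ away from the poles of the summands, \[ Z_D^{\textup{odd}}(s)=\frac{q^{s/2}}{8\Gamma(s)\log\varepsilon}\sum_{m\in\mathbb{Z}}(-1)^m\Gamma\Big(\frac{s}{2}+\frac{\pi i m}{2\log\varepsilon}\Big)\Gamma\Big(\frac{s}{2}-\frac{\pi i m}{2\log\varepsilon}\Big). \] Thus $Z_D^{\textup{odd}}(s)$ has meromorphic continuation to $s\in\mathbb{C}$, with simple poles at $s=-2k+\frac{\pi i m}{\log\varepsilon}$ for $m\in\mathbb{Z}$ and integers $k\ge0$.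
   Context: $\operatorname{Tr}$ and $N$ denote the trace and norm from $\mathbb{Q}(\sqrt D)$ to $\mathbb{Q}$. *)

theory Defs
  imports
    "HOL-Complex_Analysis.Complex_Analysis"
    "HOL-Computational_Algebra.Computational_Algebra"
begin

definition quad_field :: "int \<Rightarrow> real set" where
  "quad_field D = {a + b * sqrt (of_int D) | a b. a \<in> \<rat> \<and> b \<in> \<rat>}"

definition quad_int :: "int \<Rightarrow> real set" where
  "quad_int D = {x \<in> quad_field D. algebraic_int x}"

definition quad_units :: "int \<Rightarrow> real set" where
  "quad_units D = {x \<in> quad_int D. \<exists>y \<in> quad_int D. x * y = 1}"

definition fundamental_unit :: "int \<Rightarrow> real \<Rightarrow> bool" where
  "fundamental_unit D \<epsilon> \<longleftrightarrow>
     \<epsilon> > 1 \<and> \<epsilon> \<in> quad_units D \<and>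
     (\<forall>u \<in> quad_units D. \<exists>k::int. u = \<epsilon> powi k \<or> u = - (\<epsilon> powi k))"

(* The nontrivial automorphism of the field. The coordinates a and b are unique as soon as
   D is not a perfect square, in particular for square-free D > 1. *)
definition quad_conj :: "int \<Rightarrow> real \<Rightarrow> real" where
  "quad_conj D x =
     (THE y. \<exists>a\<in>\<rat>. \<exists>b\<in>\<rat>. x = a + b * sqrt (of_int D) \<and> y = a - b * sqrt (of_int D))"

definition quad_trace :: "int \<Rightarrow> real \<Rightarrow> real" where
  "quad_trace D x = x + quad_conj D x"

definition quad_norm :: "int \<Rightarrow> real \<Rightarrow> real" where
  "quad_norm D x = x * quad_conj D x"

definition quad_disc :: "int \<Rightarrow> int" where
  "quad_disc D = (if D mod 4 = 1 then D else 4 * D)"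

definition F_D :: "int \<Rightarrow> real \<Rightarrow> nat \<Rightarrow> real" where
  "F_D D \<epsilon> n = quad_trace D (\<epsilon> ^ n / sqrt (of_int (quad_disc D)))"

definition Z_odd_term :: "int \<Rightarrow> real \<Rightarrow> complex \<Rightarrow> nat \<Rightarrow> complex" where
  "Z_odd_term D \<epsilon> s n = complex_of_real (F_D D \<epsilon> (2 * n - 1)) powr (- s)"

(* Only meaningful for Re s > 0, where the series converges. *)
definition Z_odd :: "int \<Rightarrow> real \<Rightarrow> complex \<Rightarrow> complex" where
  "Z_odd D \<epsilon> s = (\<Sum>\<^sub>\<infinity>n\<in>{1..}. Z_odd_term D \<epsilon> s n)"

definition Gamma_summand :: "real \<Rightarrow> int \<Rightarrow> complex \<Rightarrow> complex" where
  "Gamma_summand \<epsilon> m s =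
     (-1) powi m
       * Gamma (s / 2 + of_real pi * \<i> * of_int m / (2 * of_real (ln \<epsilon>)))
       * Gamma (s / 2 - of_real pi * \<i> * of_int m / (2 * of_real (ln \<epsilon>)))"

(* The entire function rGamma is used for 1 / Gamma(s), so that the prefactor is 0 at the
   nonpositive integers. *)
definition Gamma_formula :: "int \<Rightarrow> real \<Rightarrow> complex \<Rightarrow> complex" where
  "Gamma_formula D \<epsilon> s =
     of_int (quad_disc D) powr (s / 2) * rGamma s / (8 * of_real (ln \<epsilon>))
       * (\<Sum>\<^sub>\<infinity>m\<in>(UNIV :: int set). Gamma_summand \<epsilon> m s)"

definition pole_set :: "real \<Rightarrow> complex set" where
  "pole_set \<epsilon> =
     {- 2 * of_nat k + of_real pi * \<i> * of_int m / of_real (ln \<epsilon>) | (k::nat) (m::int). True}"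

end

theory Submission
  imports Defs "HOL-Real_Asymp.Real_Asymp"
begin

text \<open>
  For odd index the Fibonacci-like number \<open>F\<^sub>D(2n - 1)\<close> is \<open>2 cosh((2n - 1) L) / sqrt q\<close> with
  \<open>L = ln \<epsilon>\<close>, so the series is a sum of values of \<open>f(u) = (2 cosh u)\<^sup>-\<^sup>s\<close> over odd multiples
  of \<open>L\<close>, and the formula is Poisson summation for \<open>f\<close>.

  It suffices to treat real \<open>s > 0\<close>, by the identity theorem. The half-line is cut into intervals of
  length \<open>2L\<close> centred at the odd multiples of \<open>L\<close>; on each of them the Dirichlet kernel recovers the
  value of \<open>f\<close> at the centre, and Tannery's theorem allows summation over the intervals. The cosine
  integrals of \<open>f\<close> satisfy the recursion \<open>4s(s + 1) J(s + 2, a) = (s\<^sup>2 + a\<^sup>2) J(s, a)\<close>, and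
  \<open>J(s, a) / J(s, 0)\<close> tends to 1 as \<open>s\<close> grows because \<open>f\<close> concentrates at 0; comparing with
  the Euler product of the Gamma function evaluates them from the real Beta integral \<open>J(s, 0)\<close>.

  The Gamma side converges locally uniformly away from the poles. Near \<open>-2k + \<pi>im/L\<close> only the
  two equal summands \<open>m\<close> and \<open>-m\<close> are singular, with a simple pole; for \<open>m = 0\<close> the double pole of
  \<open>\<Gamma>(s/2)\<^sup>2\<close> is reduced by the zero of \<open>1/\<Gamma>(s)\<close>.
\<close>

section \<open>Fourier partial sums at the centre of an interval\<close>

lemma abs_integral_bound:
  fixes f g :: "real \<Rightarrow> real"
  assumes "f integrable_on S" "g integrable_on S" "\<And>x. x \<in> S \<Longrightarrow> \<bar>f x\<bar> \<le> g x"
  shows "\<bar>integral S f\<bar> \<le> integral S g"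
  using Henstock_Kurzweil_Integration.integral_norm_bound_integral[of f S g] assms by simp

text \<open>A uniform polynomial approximation of \<open>g\<close> costs at most its error times the
  length of the interval; for the polynomial, integration by parts gains a factor 1/k.\<close>

lemma riemann_lebesgue_sin:
  fixes g :: "real \<Rightarrow> real"
  assumes g: "continuous_on {a..b} g"
  shows "((\<lambda>k. integral {a..b} (\<lambda>t. g t * sin (k * t))) \<longlongrightarrow> 0) at_top"
proof (cases "a < b")
  case False
  then consider "a = b" | "b < a" by linarith
  then show ?thesis by cases auto
next
  case True
  show ?thesis
  proof (rule tendstoI)
    fix e :: real assume e: "e > 0"
    \<comment> \<open>Integrated over the whole interval, an error of \<open>d\<close> contributes
      e/2.\<close>
    define d where "d = e / (2 * (b - a))"
    have d: "d > 0" using e True by (simp add: d_def)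
    obtain p where p: "real_polynomial_function p" "\<And>x. x \<in> {a..b} \<Longrightarrow> \<bar>g x - p x\<bar> < d"
      using Stone_Weierstrass_real_polynomial_function[OF _ g d] by blast
    obtain p' where p': "real_polynomial_function p'" "\<And>x. (p has_real_derivative p' x) (at x)"
      using has_real_derivative_polynomial_function[OF p(1)] by blast
    have cp: "continuous_on A p" "continuous_on A p'" for A
      using p(1) p'(1) by (auto intro!: continuous_at_imp_continuous_on continuous_real_polymonial_function)
    \<comment> \<open>\<open>C\<close> collects the two boundary terms and the remaining integral of
      the integration by parts, so the polynomial contributes at most C/k, below e/2 once k >
      2C/e.\<close>
    define C where "C = \<bar>p a\<bar> + \<bar>p b\<bar> + integral {a..b} (\<lambda>t. \<bar>p' t\<bar>)"
    have "eventually (\<lambda>k. k > max 0 (2 * C / e)) at_top"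
      by (rule eventually_gt_at_top)
    then show "eventually (\<lambda>k. dist (integral {a..b} (\<lambda>t. g t * sin (k * t))) 0 < e) at_top"
    proof eventually_elim
      case (elim k)
      then have k: "k > 0" and kC: "2 * C < e * k" using e by (auto simp: field_simps)
      have int: "f integrable_on {a..b}" if "continuous_on {a..b} f" for f :: "real \<Rightarrow> real"
        using that by (rule integrable_continuous_real)
      \<comment> \<open>The antiderivative is - p(t) cos(kt) / k.\<close>
      have ftc: "((\<lambda>t. p t * sin (k * t) - p' t * cos (k * t) / k) has_integral
          (- p b * cos (k * b) / k - - p a * cos (k * a) / k)) {a..b}"
        using True k
        by (intro fundamental_theorem_of_calculus)
           (auto intro!: derivative_eq_intros DERIV_subset[OF p'(2)] 
             simp flip: has_real_derivative_iff_has_vector_derivative simp: field_simps)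
      have "integral {a..b} (\<lambda>t. p t * sin (k * t) - p' t * cos (k * t) / k)
          = integral {a..b} (\<lambda>t. p t * sin (k * t)) - integral {a..b} (\<lambda>t. p' t * cos (k * t)) / k"
        using k by (subst integral_diff) (auto intro!: int continuous_intros cp)
      with ftc have eq: "integral {a..b} (\<lambda>t. p t * sin (k * t)) =
          (- p b * cos (k * b) + p a * cos (k * a) + integral {a..b} (\<lambda>t. p' t * cos (k * t))) / k"
        using k by (simp add: has_integral_iff field_simps)
      have "\<bar>integral {a..b} (\<lambda>t. p' t * cos (k * t))\<bar> \<le> integral {a..b} (\<lambda>t. \<bar>p' t\<bar>)"
        by (rule abs_integral_bound)
           (auto intro!: int continuous_intros cp simp: abs_mult mult_left_le)
      moreover have "\<bar>p b * cos (k * b)\<bar> \<le> \<bar>p b\<bar>" "\<bar>p a * cos (k * a)\<bar> \<le> \<bar>p a\<bar>"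
        by (auto simp: abs_mult mult_left_le)
      ultimately have "\<bar>- p b * cos (k * b) + p a * cos (k * a) + integral {a..b} (\<lambda>t. p' t * cos (k * t))\<bar> \<le> C"
        unfolding C_def by linarith
      then have "\<bar>integral {a..b} (\<lambda>t. p t * sin (k * t))\<bar> \<le> C / k"
        unfolding eq abs_divide using k by (simp add: divide_right_mono)
      also have "C / k < e / 2" using k kC by (simp add: field_simps)
      finally have 1: "\<bar>integral {a..b} (\<lambda>t. p t * sin (k * t))\<bar> < e / 2" .
      have "\<bar>integral {a..b} (\<lambda>t. (g t - p t) * sin (k * t))\<bar> \<le> integral {a..b} (\<lambda>t. d)"
      proof (rule abs_integral_bound)
        fix x assume x: "x \<in> {a..b}"
        have "\<bar>g x - p x\<bar> * \<bar>sin (k * x)\<bar> \<le> d * 1"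
          by (intro mult_mono) (use p(2)[OF x] d in auto)
        then show "\<bar>(g x - p x) * sin (k * x)\<bar> \<le> d" by (simp add: abs_mult)
      qed (auto intro!: int continuous_intros cp g)
      also have "\<dots> = e / 2" using True by (simp add: d_def field_simps)
      finally have 2: "\<bar>integral {a..b} (\<lambda>t. (g t - p t) * sin (k * t))\<bar> \<le> e / 2" .
      have "integral {a..b} (\<lambda>t. g t * sin (k * t)) =
          integral {a..b} (\<lambda>t. (g t - p t) * sin (k * t) + p t * sin (k * t))"
        by (simp add: algebra_simps)
      also have "\<dots> = integral {a..b} (\<lambda>t. (g t - p t) * sin (k * t)) + integral {a..b} (\<lambda>t. p t * sin (k * t))"
        by (rule integral_add) (auto intro!: int continuous_intros cp g)
      finally show ?case using 1 2 by (simp add: dist_real_def)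
    qed
  qed
qed

lemma sum_symmetric_int_Suc:
  "(\<Sum>m\<in>{- int (Suc M)..int (Suc M)}. f m) =
     (\<Sum>m\<in>{- int M..int M}. f m) + f (int (Suc M)) + (f (- int (Suc M)) :: 'a :: comm_monoid_add)"
proof -
  have "{- int (Suc M)..int (Suc M)} = insert (- int (Suc M)) (insert (int (Suc M)) {- int M..int M})"
    by auto
  then show ?thesis by (simp add: ac_simps)
qed

text \<open>Telescoping: the frequencies M+1 and -(M+1) together add 2 cos(2 pi (M+1) t), and sin(pi
  t) times this is the difference of two consecutive right-hand sides.\<close>

lemma sin_mult_dirichlet_kernel:
  "sin (pi * t) * (\<Sum>m\<in>{- int M..int M}. cos (2 * pi * of_int m * t)) = sin ((2 * real M + 1) * pi * t)"
proof (induction M)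
  case (Suc M)
  have "sin ((2 * real (Suc M) + 1) * pi * t) - sin ((2 * real M + 1) * pi * t) =
      2 * sin (pi * t) * cos (2 * pi * of_int (int (Suc M)) * t)"
    by (subst sin_diff_sin) (simp add: algebra_simps add_divide_distrib)
  moreover have "cos (2 * pi * of_int (- int (Suc M)) * t) = cos (2 * pi * of_int (int (Suc M)) * t)"
    by (metis cos_minus mult_minus_left mult_minus_right of_int_minus)
  ultimately show ?case
    unfolding sum_symmetric_int_Suc using Suc.IH by (simp only: algebra_simps)
qed auto

text \<open>Every nonzero frequency integrates to 0 over a full period.\<close>

lemma integral_dirichlet_kernel:
  "integral {-(1/2)..1/2} (\<lambda>t. \<Sum>m\<in>{- int M..int M}. cos (2 * pi * of_int m * t)) = 1"
proof -
  have *: "integral {-(1/2)..1/2} (\<lambda>t. cos (2 * pi * of_int m * t)) = (if m = 0 then 1 else 0)" for m :: int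
  proof (cases "m = 0")
    case False
    have "((\<lambda>t. cos (2 * pi * of_int m * t)) has_integral
        (sin (2 * pi * of_int m * (1/2)) / (2 * pi * of_int m) -
         sin (2 * pi * of_int m * (-(1/2))) / (2 * pi * of_int m))) {-(1/2)..1/2}"
      using False
      by (intro fundamental_theorem_of_calculus)
         (auto intro!: derivative_eq_intros simp flip: has_real_derivative_iff_has_vector_derivative)
    moreover have "sin (2 * pi * of_int m * (1/2)) = 0"
      by (simp add: sin_zero_iff_int2)
    ultimately show ?thesis using False by (simp add: has_integral_iff)
  qed auto
  show ?thesis
    by (subst integral_sum) (auto intro!: integrable_continuous_real continuous_intros simp: *)
qed

text \<open>What multiplies sin((2M+1) pi t) after h(0) is subtracted from h(t) and the Dirichlet
  kernel is written as a quotient of sines. The value at 0 fills the removable singularity when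
  \<open>d\<close> is the derivative of \<open>h\<close> there.\<close>

definition dirichlet_quotient :: "(real \<Rightarrow> real) \<Rightarrow> real \<Rightarrow> real \<Rightarrow> real" where
  "dirichlet_quotient h d t = (if t = 0 then d / pi else (h t - h 0) / sin (pi * t))"

lemma sin_pi_nonzero: "sin (pi * t) \<noteq> 0" if "t \<in> {-(1/2)..1/2}" "t \<noteq> 0"
proof -
  have "sin (pi * t) > 0 \<or> sin (pi * (-t)) > 0"
  proof (cases "t > 0")
    case True
    then show ?thesis using that mult_strict_left_mono[of t 1 pi]
      by (intro disjI1 sin_gt_zero) auto
  next
    case False
    then show ?thesis using that mult_strict_left_mono[of "-t" 1 pi]
      by (intro disjI2 sin_gt_zero) (auto simp: mult_pos_neg)
  qed
  then show ?thesis by auto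
qed

text \<open>At 0, numerator and denominator are both divided by t, so that their limits are the
  derivatives d and pi; elsewhere sin(pi t) does not vanish on the interval.\<close>

lemma continuous_on_dirichlet_quotient:
  assumes h: "continuous_on {-(1/2)..1/2} h" and d: "(h has_real_derivative d) (at 0)"
  shows "continuous_on {-(1/2)..1/2} (dirichlet_quotient h d)"
proof -
  have "((\<lambda>t. ((h t - h 0) / (t - 0)) / ((sin (pi * t) - sin (pi * 0)) / (t - 0))) \<longlongrightarrow> d / pi) (at 0)"
  proof (intro tendsto_divide)
    show "((\<lambda>t. (h t - h 0) / (t - 0)) \<longlongrightarrow> d) (at 0)"
      using d by (simp add: has_field_derivative_iff)
    have "((\<lambda>t. sin (pi * t)) has_real_derivative pi) (at 0)"
      by (auto intro!: derivative_eq_intros)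
    then show "((\<lambda>t. (sin (pi * t) - sin (pi * 0)) / (t - 0)) \<longlongrightarrow> pi) (at 0)"
      by (simp add: has_field_derivative_iff)
  qed auto
  then have "((\<lambda>t. (h t - h 0) / sin (pi * t)) \<longlongrightarrow> d / pi) (at 0)"
    by (rule tendsto_cong[THEN iffD1, rotated]) (auto simp: eventually_at_filter)
  then have "(dirichlet_quotient h d \<longlongrightarrow> d / pi) (at 0)"
    by (rule Lim_transform_eventually)
       (auto simp: eventually_at_filter dirichlet_quotient_def)
  then have 0: "isCont (dirichlet_quotient h d) 0"
    by (simp add: isCont_def dirichlet_quotient_def)
  have "continuous_on ({-(1/2)..1/2} - {0}) (\<lambda>t. (h t - h 0) / sin (pi * t))"
    using sin_pi_nonzero by (intro continuous_intros continuous_on_subset[OF h]) auto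
  then have 1: "continuous_on ({-(1/2)..1/2} - {0}) (dirichlet_quotient h d)"
    by (rule continuous_on_eq) (auto simp: dirichlet_quotient_def)
  show ?thesis
    unfolding continuous_on_eq_continuous_within
  proof
    fix x :: real assume x: "x \<in> {-(1/2)..1/2}"
    show "continuous (at x within {-(1/2)..1/2}) (dirichlet_quotient h d)"
    proof (cases "x = 0")
      case True
      then show ?thesis using 0 continuous_at_imp_continuous_at_within by blast
    next
      case False
      have "continuous (at x within {-(1/2)..1/2} \<inter> -{0}) (dirichlet_quotient h d)"
        using 1 x False by (auto simp: continuous_on_eq_continuous_within Diff_eq)
      \<comment> \<open>For x different from 0 the complement of 0 is a neighbourhood of x, so
        removing 0 does not affect continuity at x.\<close>
      moreover have "at x within {-(1/2)..1/2} \<inter> -{0} = at x within {-(1/2)..1/2}"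
        using False by (intro at_within_nhd[of x "-{0}"]) auto
      ultimately show ?thesis
        by (simp add: continuous_within)
    qed
  qed
qed

text \<open>Writing h(t) as h(0) plus h(t) - h(0): the first part is integrated by the unit mass of
  the kernel, the second turns into a sine integral to which the Riemann-Lebesgue lemma
  applies.\<close>

lemma fourier_partial_sum_center:
  assumes h: "continuous_on {-(1/2)..1/2} h" and d: "(h has_real_derivative d) (at 0)"
  shows "(\<Sum>m\<in>{- int M..int M}. integral {-(1/2)..1/2} (\<lambda>t. h t * cos (2 * pi * of_int m * t))) =
     h 0 + integral {-(1/2)..1/2} (\<lambda>t. dirichlet_quotient h d t * sin ((2 * real M + 1) * pi * t))"
proof -
  let ?K = "\<lambda>t. \<Sum>m\<in>{- int M..int M}. cos (2 * pi * of_int m * t)"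
  note int = integrable_continuous_real
  have *: "h t * ?K t = h 0 * ?K t + dirichlet_quotient h d t * sin ((2 * real M + 1) * pi * t)"
    if "t \<in> {-(1/2)..1/2}" for t
  proof (cases "t = 0")
    case False
    then have "sin (pi * t) \<noteq> 0" using sin_pi_nonzero that by blast
    then show ?thesis using False
      unfolding sin_mult_dirichlet_kernel[symmetric] dirichlet_quotient_def
      by (simp add: field_simps)
  qed auto
  have "(\<Sum>m\<in>{- int M..int M}. integral {-(1/2)..1/2} (\<lambda>t. h t * cos (2 * pi * of_int m * t))) =
      integral {-(1/2)..1/2} (\<lambda>t. h t * ?K t)"
    unfolding sum_distrib_left
    by (subst integral_sum) (auto intro!: int continuous_intros h)
  also have "\<dots> = integral {-(1/2)..1/2} 
      (\<lambda>t. h 0 * ?K t + dirichlet_quotient h d t * sin ((2 * real M + 1) * pi * t))"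
    using * by (intro integral_cong) auto
  also have "\<dots> = integral {-(1/2)..1/2} (\<lambda>t. h 0 * ?K t) +
      integral {-(1/2)..1/2} (\<lambda>t. dirichlet_quotient h d t * sin ((2 * real M + 1) * pi * t))"
    by (rule integral_add) 
       (auto intro!: int continuous_intros continuous_on_dirichlet_quotient[OF h d])
  also have "integral {-(1/2)..1/2} (\<lambda>t. h 0 * ?K t) = h 0"
    by (subst integral_mult_right) (simp only: integral_dirichlet_kernel mult_1_right)
  finally show ?thesis .
qed

lemma fourier_partial_sum_center_tendsto:
  assumes h: "continuous_on {-(1/2)..1/2} h" and d: "(h has_real_derivative d) (at 0)"
  shows "(\<lambda>M. \<Sum>m\<in>{- int M..int M}. integral {-(1/2)..1/2} (\<lambda>t. h t * cos (2 * pi * of_int m * t)))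
           \<longlonglongrightarrow> h 0"
proof -
  have "filterlim (\<lambda>M. (2 * real M + 1) * pi) at_top sequentially"
    by real_asymp
  from filterlim_compose[OF riemann_lebesgue_sin[OF continuous_on_dirichlet_quotient[OF h d]] this]
  show ?thesis
    unfolding fourier_partial_sum_center[OF h d] by (intro tendsto_eq_intros) auto
qed

text \<open>Supplies the domination for Tannery's theorem: \<open>C\<close> is fixed before
  \<open>h\<close>, \<open>K\<close> and \<open>M\<close>, because it only bounds t / sin(pi t) on
  the interval.\<close>

lemma fourier_partial_sum_center_bound:
  obtains C where "C > 0"
    "\<And>h d K M. \<lbrakk>continuous_on {-(1/2)..1/2} h; (h has_real_derivative d) (at 0);
       \<And>t. t \<in> {-(1/2)..1/2} \<Longrightarrow> \<bar>h t - h 0\<bar> \<le> K * \<bar>t\<bar>\<rbrakk> \<Longrightarrow>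
       \<bar>(\<Sum>m\<in>{- int M..int M}. integral {-(1/2)..1/2} (\<lambda>t. h t * cos (2 * pi * of_int m * t)))\<bar>
         \<le> \<bar>h 0\<bar> + C * K"
proof -
  \<comment> \<open>This instance is t / sin(pi t), continued by 1/pi at 0.\<close>
  have "compact (dirichlet_quotient (\<lambda>t. t) 1 ` {-(1/2)..1/2})"
    by (intro compact_continuous_image continuous_on_dirichlet_quotient) (auto intro!: derivative_eq_intros)
  then obtain C where C: "C > 0" "\<And>t. t \<in> {-(1/2)..1/2} \<Longrightarrow> \<bar>dirichlet_quotient (\<lambda>t. t) 1 t\<bar> \<le> C"
    by (metis bounded_pos compact_imp_bounded image_eqI real_norm_def)
  show ?thesis
  proof (rule that[OF C(1)])
    fix h d K M
    assume h: "continuous_on {-(1/2)..1/2} h" and d: "(h has_real_derivative d) (at 0)"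
      and K: "\<And>t. t \<in> {-(1/2)..1/2} \<Longrightarrow> \<bar>h t - h 0\<bar> \<le> K * \<bar>t\<bar>"
    let ?f = "\<lambda>t. dirichlet_quotient h d t * sin ((2 * real M + 1) * pi * t)"
    have cont: "continuous_on {-(1/2)..1/2} ?f"
      by (auto intro!: continuous_intros continuous_on_dirichlet_quotient[OF h d])
    \<comment> \<open>The Lipschitz hypothesis at t = 1/2 forces \<open>K\<close> to be
      nonnegative.\<close>
    have "0 \<le> K * \<bar>1/2\<bar>" by (rule order_trans[OF _ K]) auto
    then have K0: "K \<ge> 0" by simp
    have bd: "\<bar>?f t\<bar> \<le> C * K" if t: "t \<in> {-(1/2)..1/2}" for t
    proof (cases "t = 0")
      case False
      have "\<bar>dirichlet_quotient h d t\<bar> = \<bar>h t - h 0\<bar> / \<bar>sin (pi * t)\<bar>"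
        using False by (simp add: dirichlet_quotient_def)
      also have "\<dots> \<le> K * \<bar>t\<bar> / \<bar>sin (pi * t)\<bar>"
        using K[OF t] by (simp add: divide_right_mono)
      also have "\<dots> = \<bar>dirichlet_quotient (\<lambda>t. t) 1 t\<bar> * K"
        using False by (simp add: dirichlet_quotient_def)
      also have "\<dots> \<le> C * K" using C(2)[OF t] K0 by (rule mult_right_mono)
      finally show ?thesis
        by (simp add: abs_mult) (metis abs_ge_zero abs_sin_le_one mult_left_le order_trans)
    qed (use C K0 in auto)
    have "\<bar>integral {-(1/2)..1/2} ?f\<bar> \<le> integral {-(1/2)..1/2::real} (\<lambda>t. C * K)"
      by (rule abs_integral_bound) (auto intro!: integrable_continuous_real cont bd)
    then show "\<bar>(\<Sum>m\<in>{- int M..int M}. integral {-(1/2)..1/2} (\<lambda>t. h t * cos (2 * pi * of_int m * t)))\<bar>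
         \<le> \<bar>h 0\<bar> + C * K"
      unfolding fourier_partial_sum_center[OF h d] by simp
  qed
qed

section \<open>Cosine integrals of powers of the hyperbolic cosine\<close>

lemma exp_decay_integrable:
  fixes f :: "real \<Rightarrow> real"
  assumes f: "continuous_on {a..} f" and bound: "\<And>x. x \<ge> a \<Longrightarrow> \<bar>f x\<bar> \<le> C * exp (- c * x)" and c: "c > 0"
  shows "f integrable_on {a..}" "\<bar>integral {a..} f\<bar> \<le> C * (exp (- c * a) / c)"
proof -
  have g: "((\<lambda>x. C * exp (- c * x)) has_integral C * (exp (- c * a) / c)) {a..}"
    by (intro has_integral_mult_right has_integral_exp_minus_to_infinity c)
  show int: "f integrable_on {a..}"
  proof (rule measurable_bounded_by_integrable_imp_integrable_real)
    show "f \<in> borel_measurable (lebesgue_on {a..})"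
      by (rule continuous_imp_measurable_on_sets_lebesgue[OF f]) auto
    show "(\<lambda>x. C * exp (- c * x)) integrable_on {a..}" using g by blast
  qed (use bound in auto)
  show "\<bar>integral {a..} f\<bar> \<le> C * (exp (- c * a) / c)"
    using abs_integral_bound[OF int has_integral_integrable[OF g]] bound integral_unique[OF g] by simp
qed

text \<open>The missing tail starts at X, where the preceding estimate bounds it by C exp(-cX) /
  c.\<close>

lemma exp_decay_integral_tendsto:
  fixes f :: "real \<Rightarrow> real"
  assumes f: "continuous_on {a..} f" and bound: "\<And>x. x \<ge> a \<Longrightarrow> \<bar>f x\<bar> \<le> C * exp (- c * x)" and c: "c > 0"
  shows "((\<lambda>X. integral {a..X} f) \<longlongrightarrow> integral {a..} f) at_top"
proof -
  have split: "integral {a..X} f = integral {a..} f - integral {X..} f" if "X \<ge> a" for X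
  proof -
    have "{a..} = {a..X} \<union> {X..}" using that by auto
    moreover have "f integrable_on {X..}"
      by (rule exp_decay_integrable[OF continuous_on_subset[OF f] bound c]) (use that in auto)
    moreover have "f integrable_on {a..X}"
      by (intro integrable_continuous_real continuous_on_subset[OF f]) auto
    moreover have "{a..X} \<inter> {X..} \<subseteq> {X}" by auto
    then have "negligible ({a..X} \<inter> {X..})" using negligible_subset negligible_sing by blast
    ultimately show ?thesis by (simp add: integral_Un)
  qed
  have "((\<lambda>X. integral {X..} f) \<longlongrightarrow> 0) at_top"
  proof (rule Lim_null_comparison)
    show "eventually (\<lambda>X. norm (integral {X..} f) \<le> C * (exp (- c * X) / c)) at_top"
      using eventually_ge_at_top[of a]
    proof eventually_elim
      case (elim X)
      then have "\<bar>integral {X..} f\<bar> \<le> C * (exp (- c * X) / c)"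
        by (intro exp_decay_integrable(2)[OF continuous_on_subset[OF f] bound c]) auto
      then show ?case by simp
    qed
    show "((\<lambda>X. C * (exp (- c * X) / c)) \<longlongrightarrow> 0) at_top" using c by real_asymp
  qed
  then have "((\<lambda>X. integral {a..} f - integral {X..} f) \<longlongrightarrow> integral {a..} f - 0) at_top"
    by (intro tendsto_intros)
  then show ?thesis
    using split by (auto elim!: Lim_transform_eventually intro: eventually_mono[OF eventually_ge_at_top[of a]])
qed

section \<open>Powers of the hyperbolic cosine and the recursion for their cosine integrals\<close>

definition cosh_powr :: "real \<Rightarrow> real \<Rightarrow> real" where
  "cosh_powr s u = (2 * cosh u) powr (- s)"

lemma cosh_powr_pos: "cosh_powr s u > 0"
  by (simp add: cosh_powr_def)

lemma cosh_powr_le_exp: "cosh_powr s u \<le> exp (- s * u)" if "s > 0"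
proof -
  have "(2 * cosh u) powr (- s) \<le> exp u powr (- s)"
    using that by (intro powr_mono2') (auto simp: cosh_def)
  then show ?thesis by (simp add: cosh_powr_def powr_def)
qed

lemma abs_cosh_powr_mult_le: "\<bar>cosh_powr s u * x\<bar> \<le> B * exp (- s * u)" if "s > 0" "\<bar>x\<bar> \<le> B"
proof -
  have "\<bar>cosh_powr s u * x\<bar> = \<bar>x\<bar> * cosh_powr s u"
    using cosh_powr_pos[of s u] by (simp add: abs_mult)
  also have "\<dots> \<le> B * exp (- s * u)"
    using that cosh_powr_le_exp[of s u] cosh_powr_pos[of s u] by (intro mult_mono) auto
  finally show ?thesis .
qed

lemma cosh_powr_deriv [derivative_intros]:
  "(g has_real_derivative g') (at u within A) \<Longrightarrow>
   ((\<lambda>u. cosh_powr s (g u)) has_real_derivative - s * tanh (g u) * cosh_powr s (g u) * g') (at u within A)"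
  unfolding cosh_powr_def
  by (auto intro!: derivative_eq_intros simp: tanh_def field_simps powr_diff)

lemma continuous_on_cosh_powr [continuous_intros]:
  "continuous_on A g \<Longrightarrow> continuous_on A (\<lambda>u. cosh_powr s (g u))"
  unfolding cosh_powr_def by (intro continuous_intros) auto

lemma one_minus_tanh_square: "1 - tanh u ^ 2 = 1 / cosh u ^ 2" for u :: real
proof -
  have "1 - tanh u ^ 2 = (cosh u ^ 2 - sinh u ^ 2) / cosh u ^ 2"
    by (simp add: tanh_def power_divide diff_divide_distrib)
  then show ?thesis by (simp add: cosh_square_eq)
qed

text \<open>Expresses the factor 1/cosh^2 through tanh, the form produced by differentiating
  \<open>cosh_powr\<close> twice.\<close>

lemma cosh_powr_add_2: "4 * cosh_powr (s + 2) u = cosh_powr s u * (1 - tanh u ^ 2)"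
proof -
  have "cosh_powr (s + 2) u * (2 * cosh u) ^ 2 = cosh_powr s u"
  proof -
    have "(2 * cosh u) ^ 2 = (2 * cosh u) powr 2" by simp
    then show ?thesis unfolding cosh_powr_def by (simp only: flip: powr_add) simp
  qed
  then show ?thesis
    unfolding one_minus_tanh_square by (simp add: power_mult_distrib divide_simps mult_ac)
qed

definition cosh_cos_integral :: "real \<Rightarrow> real \<Rightarrow> real" where
  "cosh_cos_integral s a = integral {0..} (\<lambda>u. cosh_powr s u * cos (a * u))"

lemma cosh_cos_integrand_props:
  assumes "s > 0"
  shows "continuous_on {0..} (\<lambda>u. cosh_powr s u * cos (a * u))"
    and "\<bar>cosh_powr s u * cos (a * u)\<bar> \<le> 1 * exp (- s * u)"
    and "(\<lambda>u. cosh_powr s u * cos (a * u)) integrable_on {0..}"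
proof -
  show 1: "continuous_on {0..} (\<lambda>u. cosh_powr s u * cos (a * u))" by (intro continuous_intros)
  show 2: "\<bar>cosh_powr s u * cos (a * u)\<bar> \<le> 1 * exp (- s * u)" for u
    using assms by (intro abs_cosh_powr_mult_le) auto
  show "(\<lambda>u. cosh_powr s u * cos (a * u)) integrable_on {0..}"
    using exp_decay_integrable(1)[OF 1 2 assms] .
qed

lemma cosh_cos_integral_tendsto:
  "s > 0 \<Longrightarrow> ((\<lambda>X. integral {0..X} (\<lambda>u. cosh_powr s u * cos (a * u))) \<longlongrightarrow> cosh_cos_integral s a) at_top"
  unfolding cosh_cos_integral_def
  by (rule exp_decay_integral_tendsto[OF cosh_cos_integrand_props(1,2)])

text \<open>With f = \<open>cosh_powr s\<close>, one has f'' = s^2 f - 4 s (s+1)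
  \<open>cosh_powr (s + 2)\<close>. Two integrations by parts against cos(au) turn f'' into -a^2 f,
  since the boundary terms vanish at 0 and at infinity.\<close>

lemma cosh_cos_integral_add_2:
  assumes s: "s > 0"
  shows "4 * s * (s + 1) * cosh_cos_integral (s + 2) a = (s\<^sup>2 + a\<^sup>2) * cosh_cos_integral s a"
proof -
  \<comment> \<open>As f' = - s tanh(u) f, this is f' cos(au) + a f sin(au), whose derivative (f'' +
    a^2 f) cos(au) is \<open>G\<close>.\<close>
  define F where "F u = cosh_powr s u * (a * sin (a * u) - s * tanh u * cos (a * u))" for u
  define G where "G u = (s\<^sup>2 + a\<^sup>2) * (cosh_powr s u * cos (a * u)) - 4 * s * (s + 1) * (cosh_powr (s + 2) u * cos (a * u))" for u
  have "(F has_real_derivative G u) (at u within A)" for u A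
    unfolding F_def G_def
    using cosh_powr_add_2[of s u]
    by (auto intro!: derivative_eq_intros) algebra
  then have ftc: "(G has_integral (F X - F 0)) {0..X}" if "X \<ge> 0" for X
    using that by (intro fundamental_theorem_of_calculus)
       (auto simp flip: has_real_derivative_iff_has_vector_derivative)
  have "integral {0..X} G = (s\<^sup>2 + a\<^sup>2) * integral {0..X} (\<lambda>u. cosh_powr s u * cos (a * u))
      - 4 * s * (s + 1) * integral {0..X} (\<lambda>u. cosh_powr (s + 2) u * cos (a * u))" for X
    unfolding G_def
    by (subst integral_diff) (auto intro!: integrable_continuous_real continuous_intros)
  then have "((\<lambda>X. integral {0..X} G) \<longlongrightarrow>
      (s\<^sup>2 + a\<^sup>2) * cosh_cos_integral s a - 4 * s * (s + 1) * cosh_cos_integral (s + 2) a) at_top"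
    using s by (auto intro!: tendsto_intros cosh_cos_integral_tendsto)
  moreover have "((\<lambda>X. integral {0..X} G) \<longlongrightarrow> 0) at_top"
  proof (rule Lim_null_comparison)
    have "\<bar>F X\<bar> \<le> (\<bar>a\<bar> + s) * exp (- s * X)" for X
      unfolding F_def
    proof (rule abs_cosh_powr_mult_le[OF s])
      have "\<bar>a * sin (a * X)\<bar> \<le> \<bar>a\<bar> * 1" unfolding abs_mult by (intro mult_left_mono) auto
      moreover have "\<bar>s * tanh X * cos (a * X)\<bar> \<le> s * 1 * 1"
        unfolding abs_mult using s tanh_real_bounds[of X] by (intro mult_mono) auto
      ultimately show "\<bar>a * sin (a * X) - s * tanh X * cos (a * X)\<bar> \<le> \<bar>a\<bar> + s" by linarith
    qed
    moreover have "F 0 = 0" by (simp add: F_def)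
    ultimately show "eventually (\<lambda>X. norm (integral {0..X} G) \<le> (\<bar>a\<bar> + s) * exp (- s * X)) at_top"
      using ftc by (intro eventually_mono[OF eventually_ge_at_top[of 0]]) (simp add: has_integral_iff)
    show "((\<lambda>X. (\<bar>a\<bar> + s) * exp (- s * X)) \<longlongrightarrow> 0) at_top" using s by real_asymp
  qed
  ultimately have "(s\<^sup>2 + a\<^sup>2) * cosh_cos_integral s a - 4 * s * (s + 1) * cosh_cos_integral (s + 2) a = 0"
    by (rule tendsto_unique[rotated]) auto
  then show ?thesis by simp
qed

section \<open>Frequency zero and the Beta integral\<close>

lemma integral_Beta_half:
  assumes a: "a > (0 :: real)"
  shows "integral {1/2..1} (\<lambda>t. t powr (a - 1) * (1 - t) powr (a - 1)) = Beta a a / 2"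
proof -
  let ?f = "\<lambda>t. t powr (a - 1) * (1 - t) powr (a - 1)"
  note B = has_integral_Beta_real[OF a a]
  have int: "?f integrable_on {0..1/2}" "?f integrable_on {1/2..1}"
    by (rule integrable_on_subinterval[OF has_integral_integrable[OF B]]; force)+
  have "integral {1/2..1} ?f = integral {0..1/2} ?f"
  proof -
    \<comment> \<open>The symmetry t -> 1 - t is applied as a reflection in 0 followed by a
      translation by 1.\<close>
    have "((\<lambda>x. ?f (- x)) has_integral integral {1/2..1} ?f) {-1..-(1/2)}"
      using int(2) by (subst has_integral_reflect_real) (auto intro: integrable_integral)
    then have "((\<lambda>x. ?f (- (x - 1))) has_integral integral {1/2..1} ?f) {0..1/2}"
      using has_integral_affinity'[where m=1 and c="-1" and a="-1::real" and b="-(1/2)"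
          and f="\<lambda>x. ?f (- x)"] by simp
    moreover have "?f (- (x - 1)) = ?f x" for x by (simp add: mult.commute)
    ultimately show ?thesis by (simp add: has_integral_iff mult.commute)
  qed
  moreover have "integral {0..1/2} ?f + integral {1/2..1} ?f = integral {0..1} ?f"
    by (rule Henstock_Kurzweil_Integration.integral_combine[OF _ _ has_integral_integrable[OF B]]) auto
  ultimately show ?thesis using B by (simp add: has_integral_iff)
qed

text \<open>The substitution t = exp(u) / (2 cosh u) gives t(1-t) = (2 cosh u)^(-2) and dt = 2t(1-t)
  du. It maps the half-line onto [1/2, 1), so half of the Beta integral appears.\<close>

lemma cosh_cos_integral_0:
  assumes s: "s > 0"
  shows "cosh_cos_integral s 0 = Beta (s / 2) (s / 2) / 4"
proof -
  let ?f = "\<lambda>t. t powr (s/2 - 1) * (1 - t) powr (s/2 - 1)"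
  define g where "g u = exp u / (2 * cosh u)" for u :: real
  have g1: "1 - g u = exp (- u) / (2 * cosh u)" for u
    by (simp add: g_def field_simps) (simp add: cosh_def)
  have gpos: "g u > 0" "1 - g u > 0" for u
    unfolding g1 by (simp_all add: g_def)
  have g0: "g 0 = 1/2" by (simp add: g_def)
  have gd: "(g has_real_derivative 2 * (g u * (1 - g u))) (at u within A)" for u A
  proof -
    have "exp u * (2 * cosh u) - exp u * (2 * sinh u) = 2 * (exp u * exp (- u))"
      using cosh_minus_sinh[of u] by (simp add: algebra_simps)
    then have "2 * (g u * (1 - g u)) = (exp u * (2 * cosh u) - exp u * (2 * sinh u)) / (2 * cosh u)\<^sup>2"
      unfolding g1 by (simp add: g_def power2_eq_square)
    then show ?thesis
      unfolding g_def by (auto intro!: derivative_eq_intros simp: power2_eq_square)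
  qed
  have gmono: "g u \<le> g v" if "u \<le> v" for u v
    using that gd[of _ UNIV] gpos by (intro DERIV_nonneg_imp_nondecreasing[OF that]) (metis less_imp_le mult_nonneg_nonneg zero_le_numeral)
  have gmul: "g u * (1 - g u) = (2 * cosh u) powr - 2" for u
    unfolding g1 by (simp add: g_def powr_minus powr_realpow[of _ 2, simplified] field_simps power2_eq_square flip: exp_add)
  have key: "2 * (g u * (1 - g u)) * ?f (g u) = 2 * cosh_powr s u" for u
  proof -
    have "g u * (1 - g u) * ?f (g u) = (g u * (1 - g u)) powr 1 * (g u * (1 - g u)) powr (s/2 - 1)"
      using gpos[of u] by (simp add: powr_mult)
    also have "\<dots> = (g u * (1 - g u)) powr (s/2)" unfolding powr_add[symmetric] by simp
    also have "\<dots> = cosh_powr s u" unfolding gmul cosh_powr_def powr_powr by simp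
    finally show ?thesis by simp
  qed
  \<comment> \<open>Only finite X is substituted, since the Beta integrand may be unbounded at 1;
    the limit is taken afterwards.\<close>
  have sub: "2 * integral {0..X} (cosh_powr s) = integral {1/2..g X} ?f" if X: "X \<ge> 0" for X
  proof -
    have "((\<lambda>u. (2 * (g u * (1 - g u))) *\<^sub>R ?f (g u)) has_integral integral {g 0..g X} ?f) {0..X}"
    proof (rule has_integral_substitution[OF X gmono[OF X]])
      show "g ` {0..X} \<subseteq> {g 0..g X}" by (auto intro: gmono)
      show "continuous_on {g 0..g X} ?f"
        using gpos(2)[of X] g0 by (intro continuous_intros) auto
    qed (rule gd)
    then have "((\<lambda>u. 2 * cosh_powr s u) has_integral integral {1/2..g X} ?f) {0..X}"
      using key g0 by simp
    then show ?thesis by (simp add: has_integral_iff)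
  qed
  have "g = (\<lambda>u. exp u / (exp u + exp (- u)))" 
  proof (rule ext)
    fix u :: real
    have "2 * cosh u = exp u + exp (- u)" by (simp add: cosh_def)
    then show "g u = exp u / (exp u + exp (- u))" by (simp only: g_def)
  qed
  moreover have "filterlim (\<lambda>u::real. exp u / (exp u + exp (- u))) (at_left 1) at_top" by real_asymp
  ultimately have "filterlim g (at_left 1) at_top" by simp
  \<comment> \<open>Integrability up to the endpoint suffices for the indefinite integral to be
    continuous at 1, even if the integrand is not.\<close>
  moreover have "((\<lambda>x. integral {1/2..x} ?f) \<longlongrightarrow> integral {1/2..1} ?f) (at_left 1)"
  proof -
    have "?f integrable_on {1/2..1}"
      using s by (intro integrable_on_subinterval[OF has_integral_integrable[OF has_integral_Beta_real]]) auto
    from indefinite_integral_continuous_1[OF this]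
    have "((\<lambda>x. integral {1/2..x} ?f) \<longlongrightarrow> integral {1/2..1} ?f) (at 1 within {1/2..1})"
      by (auto simp: continuous_on_def)
    then show ?thesis by (simp add: at_within_Icc_at_left)
  qed
  ultimately have "((\<lambda>X. integral {1/2..g X} ?f) \<longlongrightarrow> integral {1/2..1} ?f) at_top"
    by (rule filterlim_compose[rotated])
  moreover have "((\<lambda>X. 2 * integral {0..X} (cosh_powr s)) \<longlongrightarrow> 2 * cosh_cos_integral s 0) at_top"
    using cosh_cos_integral_tendsto[OF s, of 0] by (intro tendsto_intros) simp
  then have "((\<lambda>X. integral {1/2..g X} ?f) \<longlongrightarrow> 2 * cosh_cos_integral s 0) at_top"
    by (rule Lim_transform_eventually) (use sub in \<open>auto intro: eventually_mono[OF eventually_ge_at_top[of 0]]\<close>)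
  ultimately have "2 * cosh_cos_integral s 0 = integral {1/2..1} ?f"
    by (rule tendsto_unique[OF trivial_limit_at_top_linorder, rotated])
  then show ?thesis using integral_Beta_half[of "s/2"] s by simp
qed

lemma cosh_cos_integral_0_pos: "s > 0 \<Longrightarrow> cosh_cos_integral s 0 > 0"
  by (simp add: cosh_cos_integral_0 Beta_def Gamma_real_pos)

section \<open>Large exponents and evaluation by Gamma functions\<close>

lemma one_minus_cos_le: "1 - cos x \<le> x\<^sup>2 / 2" for x :: real
proof -
  have "\<bar>sin (x / 2)\<bar> \<le> \<bar>x / 2\<bar>"
    using sin_x_le_x[of "\<bar>x / 2\<bar>"] sin_x_ge_neg_x[of "\<bar>x / 2\<bar>"] by (cases "x \<ge> 0") auto
  then have "(sin (x / 2))\<^sup>2 \<le> (x / 2)\<^sup>2" by (simp only: abs_le_square_iff)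
  then show ?thesis using cos_double_sin[of "x / 2"] by (simp add: power_divide)
qed

lemma sinh_ge_self: "x \<le> sinh x" if "x \<ge> 0" for x :: real
proof -
  have "sinh 0 - 0 \<le> sinh x - x"
  proof (rule DERIV_nonneg_imp_nondecreasing[OF that])
    fix y :: real
    have "((\<lambda>x. sinh x - x) has_real_derivative cosh y - 1) (at y)"
      by (auto intro!: derivative_eq_intros)
    then show "\<exists>z. ((\<lambda>x. sinh x - x) has_real_derivative z) (at y) \<and> 0 \<le> z"
      using cosh_real_ge_1[of y] by auto
  qed
  then show ?thesis by simp
qed

text \<open>Rests on \<open>u \<le> sinh u\<close>: the second moment is at most the integral of \<open>sinh\<^sup>2\<close>, which the recursion evaluates.\<close>
lemma cosh_cos_integral_ratio_bounds:
  assumes s: "s > 2"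
  shows "1 - a\<^sup>2 / (2 * (s - 2)) \<le> cosh_cos_integral s a / cosh_cos_integral s 0"
    and "cosh_cos_integral s a / cosh_cos_integral s 0 \<le> 1"
proof -
  let ?J = cosh_cos_integral
  have i0: "(\<lambda>u. cosh_powr t u) integrable_on {0..}" if "t > 0" for t
    using cosh_cos_integrand_props(3)[OF that, of 0] by simp
  have J0: "?J t 0 = integral {0..} (cosh_powr t)" for t
    by (simp add: cosh_cos_integral_def)
  note i = cosh_cos_integrand_props(3)
  have le: "?J s a \<le> ?J s 0"
    unfolding cosh_cos_integral_def using s
    by (intro integral_le i) (auto intro!: mult_left_mono simp: less_imp_le[OF cosh_powr_pos] mult_left_le)
  then show "?J s a / ?J s 0 \<le> 1" using cosh_cos_integral_0_pos[of s] s by simp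
  \<comment> \<open>The right-hand side equals \<open>cosh_powr s u\<close> times sinh(u)^2, because
    lowering the exponent by 2 multiplies by 4 cosh(u)^2.\<close>
  have pw: "cosh_powr s u * u\<^sup>2 \<le> cosh_powr (s - 2) u / 4 - cosh_powr s u" if "u \<ge> 0" for u
  proof -
    have "4 * cosh_powr s u = cosh_powr (s - 2) u * (1 - tanh u ^ 2)"
      using cosh_powr_add_2[of "s - 2" u] by simp
    moreover note one_minus_tanh_square[of u]
    ultimately have "cosh_powr (s - 2) u = 4 * cosh_powr s u * cosh u ^ 2"
      by (simp add: divide_simps)
    then have "cosh_powr (s - 2) u / 4 - cosh_powr s u = cosh_powr s u * sinh u ^ 2"
      by (simp add: cosh_square_eq algebra_simps)
    moreover have "u\<^sup>2 \<le> sinh u ^ 2" using sinh_ge_self[OF that] that by (rule power_mono)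
    ultimately show ?thesis using cosh_powr_pos[of s u] by simp
  qed
  have "?J s 0 - ?J s a = integral {0..} (\<lambda>u. cosh_powr s u - cosh_powr s u * cos (a * u))"
    unfolding J0 unfolding cosh_cos_integral_def using s by (subst integral_diff) (auto intro!: i i0)
  also have "\<dots> \<le> integral {0..} (\<lambda>u. a\<^sup>2 / 2 * (cosh_powr (s - 2) u / 4 - cosh_powr s u))"
  proof (rule integral_le)
    fix u :: real assume u: "u \<in> {0..}"
    have "cosh_powr s u - cosh_powr s u * cos (a * u) = cosh_powr s u * (1 - cos (a * u))"
      by (simp add: algebra_simps)
    also have "\<dots> \<le> cosh_powr s u * ((a * u)\<^sup>2 / 2)"
      by (intro mult_left_mono one_minus_cos_le less_imp_le[OF cosh_powr_pos])
    also have "\<dots> = a\<^sup>2 / 2 * (cosh_powr s u * u\<^sup>2)" by (simp add: power_mult_distrib)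
    also have "\<dots> \<le> a\<^sup>2 / 2 * (cosh_powr (s - 2) u / 4 - cosh_powr s u)"
      using pw u by (intro mult_left_mono) auto
    finally show "cosh_powr s u - cosh_powr s u * cos (a * u) \<le> a\<^sup>2 / 2 * (cosh_powr (s - 2) u / 4 - cosh_powr s u)" .
  next
    show "(\<lambda>u. a\<^sup>2 / 2 * (cosh_powr (s - 2) u / 4 - cosh_powr s u)) integrable_on {0..}"
      using s by (intro integrable_on_mult_right integrable_diff i0 integrable_on_divide) auto
  qed (use s in \<open>auto intro!: integrable_diff i i0\<close>)
  also have "\<dots> = a\<^sup>2 / 2 * (?J (s - 2) 0 / 4 - ?J s 0)"
    unfolding J0 using s by (simp add: integral_diff i0)
  \<comment> \<open>The recursion at s - 2 and frequency 0, with a common factor s - 2 cancelled;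
    here s > 2 enters.\<close>
  also have "?J (s - 2) 0 / 4 - ?J s 0 = ?J s 0 / (s - 2)"
  proof -
    have "(s - 2) * (4 * (s - 1) * ?J s 0) = (s - 2) * ((s - 2) * ?J (s - 2) 0)"
      using cosh_cos_integral_add_2[of "s - 2" 0] s by (simp add: algebra_simps power2_eq_square)
    then have "4 * (s - 1) * ?J s 0 = (s - 2) * ?J (s - 2) 0"
      using s by simp
    then show ?thesis using s by (simp add: field_simps)
  qed
  finally show "1 - a\<^sup>2 / (2 * (s - 2)) \<le> ?J s a / ?J s 0"
    using cosh_cos_integral_0_pos[of s] s by (simp add: field_simps)
qed

lemma cosh_cos_integral_ratio_tendsto:
  assumes s: "s > 0"
  shows "(\<lambda>N. cosh_cos_integral (s + 2 * real N) a / cosh_cos_integral (s + 2 * real N) 0) \<longlonglongrightarrow> 1"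
proof (rule tendsto_sandwich)
  have ev: "eventually (\<lambda>N. s + 2 * real N > 2) sequentially"
    using s by (intro eventually_mono[OF eventually_ge_at_top[of 1]]) auto
  show "eventually (\<lambda>N. 1 - a\<^sup>2 / (2 * (s + 2 * real N - 2)) \<le>
      cosh_cos_integral (s + 2 * real N) a / cosh_cos_integral (s + 2 * real N) 0) sequentially"
    using ev by eventually_elim (rule cosh_cos_integral_ratio_bounds)
  show "eventually (\<lambda>N. cosh_cos_integral (s + 2 * real N) a / cosh_cos_integral (s + 2 * real N) 0 \<le> 1) sequentially"
    using ev by eventually_elim (rule cosh_cos_integral_ratio_bounds)
  show "(\<lambda>N. 1 - a\<^sup>2 / (2 * (s + 2 * real N - 2))) \<longlonglongrightarrow> 1" by real_asymp
qed auto

text \<open>Dividing the recursion at frequency a by the one at frequency 0 cancels 4t(t+1) and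
  leaves (t^2 + a^2) / t^2. Halving t and a puts the product in the shape of quotients of Pochhammer
  symbols.\<close>

lemma cosh_cos_integral_ratio_shift:
  assumes s: "s > 0"
  shows "cosh_cos_integral s a / cosh_cos_integral s 0 *
      (\<Prod>j<N. ((s / 2 + real j)\<^sup>2 + (a / 2)\<^sup>2) / (s / 2 + real j)\<^sup>2) =
    cosh_cos_integral (s + 2 * real N) a / cosh_cos_integral (s + 2 * real N) 0"
proof (induction N)
  case (Suc N)
  let ?J = cosh_cos_integral
  define t where "t = s + 2 * real N"
  have t: "t > 0" using s by (simp add: t_def)
  have "((s / 2 + real N)\<^sup>2 + (a / 2)\<^sup>2) / (s / 2 + real N)\<^sup>2 = (t\<^sup>2 + a\<^sup>2) / t\<^sup>2"
  proof -
    have "(s / 2 + real N)\<^sup>2 = t\<^sup>2 / 4" unfolding t_def by (simp add: power2_eq_square field_simps)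
    then show ?thesis unfolding \<open>(s / 2 + real N)\<^sup>2 = t\<^sup>2 / 4\<close>
      using t by (simp add: power_divide field_simps)
  qed
  moreover have "?J t a / ?J t 0 * ((t\<^sup>2 + a\<^sup>2) / t\<^sup>2) = ?J (t + 2) a / ?J (t + 2) 0"
  proof -
    have 1: "?J (t + 2) a = (t\<^sup>2 + a\<^sup>2) * ?J t a / (4 * t * (t + 1))" for a
    proof -
      have "4 * t * (t + 1) \<noteq> 0" using t by auto
      then show ?thesis
        using cosh_cos_integral_add_2[OF t, of a] by (metis nonzero_mult_div_cancel_left)
    qed
    show ?thesis unfolding 1 using t cosh_cos_integral_0_pos[OF t] by (simp add: mult.commute)
  qed
  moreover have "t + 2 = s + 2 * real (Suc N)" by (simp add: t_def)
  ultimately show ?case using Suc by (simp flip: t_def mult.assoc)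
qed auto

text \<open>The j-th factors are complex conjugates, so each pair multiplies to a squared modulus;
  these are the numerators of the shift product.\<close>

lemma pochhammer_conjugate_pair:
  fixes x y :: real
  defines "z \<equiv> complex_of_real x" and "w \<equiv> \<i> * complex_of_real y"
  shows "pochhammer (z + w) n * pochhammer (z - w) n = of_real (\<Prod>j<n. (x + real j)\<^sup>2 + y\<^sup>2)"
proof -
  have "(z + w + of_nat j) * (z - w + of_nat j) = of_real ((x + real j)\<^sup>2 + y\<^sup>2)" for j
    by (simp add: z_def w_def algebra_simps power2_eq_square complex_eq_iff)
  then show ?thesis
    by (simp add: pochhammer_prod atLeast0LessThan flip: prod.distrib)
qed

text \<open>The shift product is a quotient of approximants of 1/Gamma at z+w, z-w and z, and the
  shifted ratio tends to 1. This yields the ratio to frequency 0 as a Gamma quotient, and the Beta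
  value supplies the rest.\<close>

lemma cosh_cos_integral_eq_Gamma:
  assumes s: "s > 0"
  shows "complex_of_real (cosh_cos_integral s a) =
    Gamma (of_real s / 2 + \<i> * of_real (a / 2)) * Gamma (of_real s / 2 - \<i> * of_real (a / 2)) * rGamma (of_real s) / 4"
proof -
  let ?J = cosh_cos_integral
  define z where "z = complex_of_real (s / 2)"
  define w where "w = \<i> * complex_of_real (a / 2)"
  define R where "R = complex_of_real (?J s a / ?J s 0)"
  have nz: "x \<notin> \<int>\<^sub>\<le>\<^sub>0" if "Re x > 0" for x
    using that by (auto elim!: nonpos_Ints_cases)
  have nzs: "z \<notin> \<int>\<^sub>\<le>\<^sub>0" "z + w \<notin> \<int>\<^sub>\<le>\<^sub>0" "z - w \<notin> \<int>\<^sub>\<le>\<^sub>0" "of_real s \<notin> (\<int>\<^sub>\<le>\<^sub>0 :: complex set)"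
    using s by (auto intro!: nz simp: z_def w_def)
  \<comment> \<open>The n-th approximant contains n+1 Pochhammer factors, hence \<open>Suc n\<close>
    shifts.\<close>
  have "R * (rGamma_series (z + w) n * rGamma_series (z - w) n / rGamma_series z n ^ 2) =
      of_real (?J (s + 2 * real (Suc n)) a / ?J (s + 2 * real (Suc n)) 0)" for n
  proof -
    \<comment> \<open>For n > 0 these are n^z and n^w; both cancel in the quotient, as do the
      factorials.\<close>
    define e where "e = exp (z * of_real (ln (real n)))"
    define v where "v = exp (w * of_real (ln (real n)))"
    have ne: "e \<noteq> 0" "v \<noteq> 0" by (auto simp: e_def v_def)
    have "rGamma_series (z + w) n * rGamma_series (z - w) n / rGamma_series z n ^ 2 =
       (pochhammer (z + w) (Suc n) / (fact n * (e * v))) * (pochhammer (z - w) (Suc n) / (fact n * (e / v))) /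
       (pochhammer z (Suc n) / (fact n * e)) ^ 2"
      by (simp add: rGamma_series_def e_def v_def exp_add exp_diff ring_distribs)
    also have "\<dots> = (pochhammer (z + w) (Suc n) * pochhammer (z - w) (Suc n)) / (pochhammer z (Suc n))\<^sup>2"
      using ne by (simp add: power2_eq_square)
    also have "pochhammer (z + w) (Suc n) * pochhammer (z - w) (Suc n) =
        of_real (\<Prod>j<Suc n. (s / 2 + real j)\<^sup>2 + (a / 2)\<^sup>2)"
      unfolding z_def w_def by (rule pochhammer_conjugate_pair)
    also have "(pochhammer z (Suc n))\<^sup>2 = of_real (\<Prod>j<Suc n. (s / 2 + real j)\<^sup>2)"
      using pochhammer_conjugate_pair[of "s/2" 0 "Suc n"] by (simp add: z_def power2_eq_square)
    also have "of_real (\<Prod>j<Suc n. (s / 2 + real j)\<^sup>2 + (a / 2)\<^sup>2) / of_real (\<Prod>j<Suc n. (s / 2 + real j)\<^sup>2) =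
        complex_of_real (\<Prod>j<Suc n. ((s / 2 + real j)\<^sup>2 + (a / 2)\<^sup>2) / (s / 2 + real j)\<^sup>2)"
      by (simp only: prod_dividef of_real_divide)
    finally have "R * (rGamma_series (z + w) n * rGamma_series (z - w) n / rGamma_series z n ^ 2) =
       of_real (?J s a / ?J s 0 * (\<Prod>j<Suc n. ((s / 2 + real j)\<^sup>2 + (a / 2)\<^sup>2) / (s / 2 + real j)\<^sup>2))"
      by (simp only: R_def of_real_mult)
    then show ?thesis unfolding cosh_cos_integral_ratio_shift[OF s] .
  qed
  moreover have "(\<lambda>n. complex_of_real (?J (s + 2 * real (Suc n)) a / ?J (s + 2 * real (Suc n)) 0)) \<longlonglongrightarrow> of_real 1"
    by (intro tendsto_of_real filterlim_compose[OF cosh_cos_integral_ratio_tendsto[OF s] filterlim_Suc])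
  moreover have "(\<lambda>n. R * (rGamma_series (z + w) n * rGamma_series (z - w) n / rGamma_series z n ^ 2))
      \<longlonglongrightarrow> R * (rGamma (z + w) * rGamma (z - w) / rGamma z ^ 2)"
    using nzs by (intro tendsto_intros) (auto simp: rGamma_eq_zero_iff)
  ultimately have "R * (rGamma (z + w) * rGamma (z - w) / rGamma z ^ 2) = 1"
    using LIMSEQ_unique by force
  then have "R = Gamma (z + w) * Gamma (z - w) / Gamma z ^ 2"
    using nzs by (simp add: rGamma_inverse_Gamma Gamma_eq_zero_iff field_simps)
  moreover have "complex_of_real (?J s 0) = Gamma z ^ 2 * rGamma (of_real s) / 4"
    unfolding z_def Gamma_complex_of_real rGamma_complex_of_real cosh_cos_integral_0[OF s]
    by (simp add: Beta_altdef power2_eq_square)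
  moreover have "complex_of_real (?J s a) = R * of_real (?J s 0)"
    using cosh_cos_integral_0_pos[OF s] by (simp add: R_def)
  ultimately have "complex_of_real (?J s a) =
      (Gamma (z + w) * Gamma (z - w) / Gamma z ^ 2) * (Gamma z ^ 2 * rGamma (of_real s) / 4)" by (simp only:)
  also have "\<dots> = Gamma (z + w) * Gamma (z - w) * rGamma (of_real s) / 4"
    using nzs by (simp add: Gamma_eq_zero_iff)
  finally show ?thesis by (simp add: z_def w_def)
qed

section \<open>Poisson summation\<close>

text \<open>Cutting at the even multiples of L makes the odd multiples the centres of the
  pieces.\<close>

lemma cosh_cos_integral_sums:
  assumes s: "s > 0" and L: "L > 0"
  shows "(\<lambda>n. integral {2 * real n * L..2 * real (Suc n) * L} (\<lambda>u. cosh_powr s u * cos (a * u)))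
    sums cosh_cos_integral s a"
proof -
  let ?f = "\<lambda>u. cosh_powr s u * cos (a * u)"
  have "(\<Sum>n<N. integral {2 * real n * L..2 * real (Suc n) * L} ?f) = integral {0..2 * real N * L} ?f" for N
  proof (induction N)
    case (Suc N)
    have "integral {0..2 * real N * L} ?f + integral {2 * real N * L..2 * real (Suc N) * L} ?f =
        integral {0..2 * real (Suc N) * L} ?f"
      using L by (intro Henstock_Kurzweil_Integration.integral_combine integrable_continuous_real continuous_intros)
        (auto simp: mult_right_mono)
    then show ?case using Suc by simp
  qed auto
  moreover have "(\<lambda>N. integral {0..2 * real N * L} ?f) \<longlonglongrightarrow> cosh_cos_integral s a"
  proof (rule filterlim_compose[OF cosh_cos_integral_tendsto[OF s]])
    show "filterlim (\<lambda>N. 2 * real N * L) at_top sequentially" using L by real_asymp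
  qed
  ultimately show ?thesis by (simp add: sums_def)
qed

text \<open>The derivative is - s tanh times the function, hence at most s exp(-sa) beyond a. This
  decay makes the constants of successive intervals summable.\<close>

lemma cosh_powr_lipschitz:
  assumes s: "s > 0" and a: "x \<ge> a" "y \<ge> a" "a \<ge> 0"
  shows "\<bar>cosh_powr s x - cosh_powr s y\<bar> \<le> s * exp (- s * a) * \<bar>x - y\<bar>"
proof -
  have "norm (cosh_powr s x - cosh_powr s y) \<le> (s * exp (- s * a)) * norm (x - y)"
  proof (rule field_differentiable_bound[of "{a..}"])
    fix u assume u: "u \<in> {a..}"
    show "(cosh_powr s has_field_derivative - s * tanh u * cosh_powr s u) (at u within {a..})"
      using cosh_powr_deriv[of "\<lambda>x. x" 1 u "{a..}" s] by simp
    have "\<bar>cosh_powr s u * (- s * tanh u)\<bar> \<le> s * exp (- s * u)"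
      using s tanh_real_bounds[of u] by (intro abs_cosh_powr_mult_le) (auto simp: abs_mult)
    also have "\<dots> \<le> s * exp (- s * a)" using u s by auto
    finally show "norm (- s * tanh u * cosh_powr s u) \<le> s * exp (- s * a)" by (simp add: mult_ac)
  qed (use a in auto)
  then show ?thesis by simp
qed

text \<open>On each interval, rescaled to length 1, the symmetric Fourier sums tend to the value at
  the centre, with a bound geometric in n and uniform in M. Tannery's theorem sums these limits; for
  fixed m the coefficients add up to a half-line cosine integral.\<close>

lemma poisson_cosh_powr:
  assumes s: "s > 0" and L: "L > 0"
  shows "(\<lambda>M. \<Sum>m\<in>{- int M..int M}. (if even m then 1 else -1) * cosh_cos_integral s (pi * of_int m / L) / (2 * L))
     \<longlonglongrightarrow> (\<Sum>n. cosh_powr s ((2 * real n + 1) * L))"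
proof -
  define x where "x n = (2 * real n + 1) * L" for n
  define h where "h n t = cosh_powr s (x n + 2 * L * t)" for n t
  define c where "c n m = integral {-(1/2)..1/2} (\<lambda>t. h n t * cos (2 * pi * of_int m * t))" for n and m :: int
  define A where "A n M = (\<Sum>m\<in>{- int M..int M}. c n m)" for n M
  have cont: "continuous_on {-(1/2)..1/2} (h n)" for n
    unfolding h_def by (intro continuous_intros)
  have der: "(h n has_real_derivative - s * tanh (x n) * cosh_powr s (x n) * (2 * L)) (at 0)" for n
    unfolding h_def by (auto intro!: derivative_eq_intros)
  have lip: "\<bar>h n t - h n 0\<bar> \<le> (2 * L * s * exp (- s * (2 * real n * L))) * \<bar>t\<bar>"
    if t: "t \<in> {-(1/2)..1/2}" for n t
  proof -
    \<comment> \<open>The rescaled point stays to the right of the left endpoint 2nL, where the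
      Lipschitz constant is taken.\<close>
    have "L * - 1 \<le> L * (2 * t)" using t L by (intro mult_left_mono) auto
    then have "\<bar>h n t - h n 0\<bar> \<le> s * exp (- s * (2 * real n * L)) * \<bar>(x n + 2 * L * t) - (x n + 2 * L * 0)\<bar>"
      unfolding h_def using L by (intro cosh_powr_lipschitz s) (auto simp: x_def algebra_simps)
    also have "\<dots> = (2 * L * s * exp (- s * (2 * real n * L))) * \<bar>t\<bar>"
      using L by (simp add: abs_mult)
    finally show ?thesis .
  qed
  obtain C where C: "C > 0" and C_bound: "\<And>h d K M. \<lbrakk>continuous_on {-(1/2)..1/2} h; (h has_real_derivative d) (at 0);
       \<And>t. t \<in> {-(1/2)..1/2} \<Longrightarrow> \<bar>h t - h 0\<bar> \<le> K * \<bar>t\<bar>\<rbrakk> \<Longrightarrow>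
       \<bar>(\<Sum>m\<in>{- int M..int M}. integral {-(1/2)..1/2} (\<lambda>t. h t * cos (2 * pi * of_int m * t)))\<bar>
         \<le> \<bar>h 0\<bar> + C * K"
    using fourier_partial_sum_center_bound by blast
  have bd: "\<bar>A n M\<bar> \<le> \<bar>h n 0\<bar> + C * (2 * L * s * exp (- s * (2 * real n * L)))" for n M
    unfolding A_def c_def by (rule C_bound[OF cont der lip])
  have geo: "exp (- s * (2 * real n * L)) = exp (- (2 * s * L)) ^ n" for n
    by (simp flip: exp_of_nat_mult add: mult_ac)
  have h0: "\<bar>h n 0\<bar> \<le> exp (- (2 * s * L)) ^ n" for n
  proof -
    have "\<bar>h n 0\<bar> \<le> exp (- s * x n)"
      using cosh_powr_le_exp[OF s, of "x n"] cosh_powr_pos[of s "x n"] by (simp add: h_def)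
    also have "\<dots> \<le> exp (- s * (2 * real n * L))" using s L by (simp add: x_def)
    finally show ?thesis unfolding geo .
  qed
  have sm: "summable (\<lambda>n. (1 + C * (2 * L * s)) * exp (- (2 * s * L)) ^ n)"
    using s L by (intro summable_mult summable_geometric) auto
  have bd': "\<bar>A n M\<bar> \<le> (1 + C * (2 * L * s)) * exp (- (2 * s * L)) ^ n" for n M
    using bd[of n M] h0[of n] unfolding geo by (simp add: algebra_simps)
  have lim: "(\<lambda>M. A n M) \<longlonglongrightarrow> h n 0" for n
    unfolding A_def c_def by (rule fourier_partial_sum_center_tendsto[OF cont der])
  have tan: "(\<lambda>M. \<Sum>n. A n M) \<longlonglongrightarrow> (\<Sum>n. h n 0)"
    using tannerys_theorem[of A "\<lambda>n. h n 0" sequentially, OF lim _ sm] bd' by (auto intro!: always_eventually)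
  have cn: "c n m = (if even m then 1 else -1) / (2 * L) *
     integral {2 * real n * L..2 * real (Suc n) * L} (\<lambda>u. cosh_powr s u * cos (pi * of_int m / L * u))" for n m
  proof -
    let ?f = "\<lambda>u. cosh_powr s u * cos (pi * of_int m / L * u)"
    define g where "g t = x n + 2 * L * t" for t
    have e: "g (-(1/2)) = 2 * real n * L" "g (1/2) = 2 * real (Suc n) * L"
      by (simp_all add: g_def x_def algebra_simps)
    have "((\<lambda>t. (2 * L) *\<^sub>R ?f (g t)) has_integral integral {g (-(1/2))..g (1/2)} ?f) {-(1/2)..1/2}"
    proof (rule has_integral_substitution)
      have "g t \<le> g t'" if "t \<le> t'" for t t'
        using L that by (simp add: g_def)
      then show "g ` {-(1/2)..1/2} \<subseteq> {g (-(1/2))..g (1/2)}" by auto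
    qed (use L in \<open>auto simp: g_def intro!: continuous_intros derivative_eq_intros\<close>)
    moreover have "(2 * L) *\<^sub>R ?f (g t) = (2 * L * (if even m then 1 else -1)) * (h n t * cos (2 * pi * of_int m * t))" for t
    proof -
      \<comment> \<open>The phase at the centre is an odd multiple of pi m, which produces the sign
        (-1)^m independently of n.\<close>
      have "pi * of_int m / L * g t = 2 * pi * of_int m * t + pi * of_int (m * (2 * int n + 1))"
        using L by (simp add: g_def x_def field_simps)
      moreover have "sin (pi * of_int (m * (2 * int n + 1))) = 0" by (rule sin_npi_int)
      moreover have "cos (pi * of_int (m * (2 * int n + 1))) = (if even m then 1 else -1)"
        unfolding cos_npi_int by simp
      ultimately show ?thesis by (simp only: cos_add) (simp add: h_def g_def)
    qed
    ultimately have "((\<lambda>t. (2 * L * (if even m then 1 else -1)) * (h n t * cos (2 * pi * of_int m * t))) has_integral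
        integral {2 * real n * L..2 * real (Suc n) * L} ?f) {-(1/2)..1/2}"
      by (simp only: e)
    from integral_unique[OF this]
    have "integral {2 * real n * L..2 * real (Suc n) * L} ?f = (2 * L * (if even m then 1 else -1)) * c n m"
      unfolding c_def integral_mult_right by (rule sym)
    then show ?thesis using L by (cases "even m") simp_all
  qed
  have "(\<lambda>n. c n m) sums ((if even m then 1 else -1) / (2 * L) * cosh_cos_integral s (pi * of_int m / L))" for m
    unfolding cn by (intro sums_mult cosh_cos_integral_sums s L)
  \<comment> \<open>For fixed M only finitely many frequencies occur, so the sums over m and n may
    be exchanged.\<close>
  then have "(\<lambda>n. A n M) sums (\<Sum>m\<in>{- int M..int M}. (if even m then 1 else -1) / (2 * L) * cosh_cos_integral s (pi * of_int m / L))" for M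
    unfolding A_def by (intro sums_sum)
  then have "(\<Sum>n. A n M) = (\<Sum>m\<in>{- int M..int M}. (if even m then 1 else -1) * cosh_cos_integral s (pi * of_int m / L) / (2 * L))" for M
    by (simp add: sums_iff)
  with tan show ?thesis by (simp add: h_def x_def)
qed

section \<open>The sum of Gamma products\<close>

text \<open>In Euler's integral the modulus of t^(z-1) depends only on Re z.\<close>

lemma norm_Gamma_le: "norm (Gamma z) \<le> Gamma (Re z)" if "Re z > 0" for z :: complex
proof -
  note c = Gamma_integral_complex[OF that]
  note r = Gamma_integral_real[OF that]
  have "norm (integral {0..} (\<lambda>t. of_real t powr (z - 1) / of_real (exp t))) \<le>
      integral {0..} (\<lambda>t. t powr (Re z - 1) / exp t)"
    by (rule Henstock_Kurzweil_Integration.integral_norm_bound_integral)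
       (use c r in \<open>auto simp: has_integral_iff norm_divide norm_powr_real_powr\<close>)
  then show ?thesis using c r by (simp add: has_integral_iff)
qed

text \<open>Every factor has modulus at least |Im z|, which is at least 1: one factor gives the
  bound and the others cannot spoil it. Linear growth suffices, since two Gamma factors then decay
  like 1/y^2.\<close>

lemma norm_pochhammer_ge:
  fixes z :: complex
  assumes "\<bar>Im z\<bar> \<ge> 1" "n \<ge> 1"
  shows "norm (pochhammer z n) \<ge> \<bar>Im z\<bar>"
  using assms(2)
proof (induction n rule: dec_induct)
  case base
  then show ?case using abs_Im_le_cmod[of z] by simp
next
  case (step n)
  have "\<bar>Im z\<bar> * 1 \<le> norm (pochhammer z n) * norm (z + of_nat n)"
    using step assms(1) abs_Im_le_cmod[of "z + of_nat n"] by (intro mult_mono) auto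
  then show ?case by (simp add: pochhammer_Suc norm_mult)
qed

lemma not_nonpos_Ints_complex: "z \<notin> \<int>\<^sub>\<le>\<^sub>0" if "Im z \<noteq> 0 \<or> Re z > 0" for z :: complex
  using that by (auto elim!: nonpos_Ints_cases)

definition Gamma_pair :: "real \<Rightarrow> complex \<Rightarrow> complex" where
  "Gamma_pair y s = Gamma (s / 2 + \<i> * of_real y) * Gamma (s / 2 - \<i> * of_real y)"

text \<open>Shifting both arguments to the right gives decay in \<open>y\<close>, since the shifted factors are bounded.\<close>
lemma Gamma_pair_bound:
  obtains C where "C \<ge> 0"
    "\<And>s y. \<lbrakk>norm s \<le> R; \<bar>y\<bar> \<ge> R + 2\<rbrakk> \<Longrightarrow> norm (Gamma_pair y s) \<le> C / y\<^sup>2"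
proof -
  \<comment> \<open>After a shift by \<open>N\<close> the real part of the argument lies in a
    compact interval to the right of 1, where the real Gamma function is bounded by
    \<open>K\<close>.\<close>
  define N where "N = nat \<lceil>\<bar>R\<bar>\<rceil> + 1"
  have N: "N \<ge> 1" "real N \<ge> \<bar>R\<bar> / 2 + 1" unfolding N_def by linarith+
  have "compact (Gamma ` {1..\<bar>R\<bar> + real N})"
    by (intro compact_continuous_image continuous_on_Gamma) (auto elim!: nonpos_Ints_cases)
  then obtain K where K: "K > 0" "\<And>x. x \<in> {1..\<bar>R\<bar> + real N} \<Longrightarrow> \<bar>Gamma x\<bar> \<le> K"
    by (metis bounded_pos compact_imp_bounded image_eqI real_norm_def)
  have single: "norm (Gamma z) \<le> K / (y / 2)"
    if z: "\<bar>Re z\<bar> \<le> R / 2" "\<bar>Im z\<bar> \<ge> y / 2" and y: "y \<ge> R + 2" for z y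
  proof -
    have R: "R \<ge> 0" using z(1) by linarith
    have "y / 2 \<ge> 1" using y R by linarith
    with z have im: "\<bar>Im z\<bar> \<ge> 1" by linarith
    have re: "Re z + real N \<in> {1..\<bar>R\<bar> + real N}" using z N R by auto
    have p: "norm (pochhammer z N) \<ge> y / 2" using norm_pochhammer_ge[OF im N(1)] z by linarith
    have nz: "z \<notin> \<int>\<^sub>\<le>\<^sub>0" using im by (intro not_nonpos_Ints_complex) auto
    then have "Gamma z * pochhammer z N = Gamma (z + of_nat N)"
      by (simp add: pochhammer_Gamma Gamma_eq_zero_iff)
    then have "norm (Gamma z) * norm (pochhammer z N) = norm (Gamma (z + of_nat N))"
      by (metis norm_mult)
    also have "\<dots> \<le> Gamma (Re z + real N)"
      using norm_Gamma_le[of "z + of_nat N"] re by simp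
    also have "\<dots> \<le> K" using K(2)[OF re] by linarith
    finally have "norm (Gamma z) * norm (pochhammer z N) \<le> K" .
    moreover have "norm (Gamma z) * (y / 2) \<le> norm (Gamma z) * norm (pochhammer z N)"
      using p by (rule mult_left_mono) simp
    ultimately show ?thesis using \<open>y / 2 \<ge> 1\<close> by (simp add: field_simps)
  qed
  show ?thesis
  proof (rule that[of "4 * K\<^sup>2"])
    fix s :: complex and y :: real assume s: "norm s \<le> R" and y: "\<bar>y\<bar> \<ge> R + 2"
    have R: "R \<ge> 0" using s norm_ge_zero[of s] by linarith
    have s': "\<bar>Re s\<bar> \<le> R" "\<bar>Im s\<bar> \<le> R" using s abs_Re_le_cmod[of s] abs_Im_le_cmod[of s] by linarith+
    \<comment> \<open>Half of Im s is at most R/2, too small to cancel more than half of y. Each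
      Gamma factor is then at most 2K/|y|, which explains the constant
      \<open>4 * K\<^sup>2\<close>.\<close>
    have im: "\<bar>y\<bar> / 2 \<le> \<bar>Im s / 2 + y\<bar>" "\<bar>y\<bar> / 2 \<le> \<bar>Im s / 2 - y\<bar>"
      using s' y R by linarith+
    have "norm (Gamma_pair y s) \<le> (K / (\<bar>y\<bar> / 2)) * (K / (\<bar>y\<bar> / 2))"
      unfolding Gamma_pair_def norm_mult using s' y R K(1) im
      by (intro mult_mono single) auto
    then show "norm (Gamma_pair y s) \<le> 4 * K\<^sup>2 / y\<^sup>2"
      by (simp add: power2_eq_square abs_mult_self_eq field_simps)
  qed auto
qed

lemma Gamma_pair_analytic:
  assumes "s / 2 + \<i> * of_real y \<notin> \<int>\<^sub>\<le>\<^sub>0" "s / 2 - \<i> * of_real y \<notin> \<int>\<^sub>\<le>\<^sub>0"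
  shows "Gamma_pair y analytic_on {s}"
  unfolding Gamma_pair_def using assms by (intro analytic_intros) auto

text \<open>The term at m = 0 is 0 by the convention 1/0 = 0; the others are two copies of the
  series over the naturals.\<close>

lemma summable_on_inverse_square_int: "(\<lambda>m::int. 1 / (of_int m)\<^sup>2 :: real) summable_on A"
proof -
  have nat: "(\<lambda>n::nat. 1 / (real n)\<^sup>2) summable_on UNIV"
    using inverse_power_summable[of 2, where 'a=real]
    by (subst summable_on_UNIV_nonneg_real_iff) (auto simp: inverse_eq_divide)
  have 1: "(\<lambda>m::int. 1 / (of_int m)\<^sup>2 :: real) summable_on range int"
    using nat by (subst summable_on_reindex) (auto simp: o_def)
  have 2: "(\<lambda>m::int. 1 / (of_int m)\<^sup>2 :: real) summable_on range (\<lambda>n. - int n)"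
    using nat by (subst summable_on_reindex) (auto simp: o_def inj_on_def)
  have "(\<lambda>m::int. 1 / (of_int m)\<^sup>2 :: real) summable_on (range int \<union> (range (\<lambda>n. - int n) - range int))"
    by (intro summable_on_Un_disjoint[OF 1 summable_on_subset_banach[OF 2]]) auto
  then show ?thesis
    by (rule summable_on_subset_banach) (auto simp: image_iff; metis int_cases2)
qed

lemma Gamma_summand_eq:
  "Gamma_summand \<epsilon> m s = (-1) powi m * Gamma_pair (pi * of_int m / (2 * ln \<epsilon>)) s"
  by (simp add: Gamma_summand_def Gamma_pair_def mult_ac)

lemma norm_powi_minus_one: "norm ((-1 :: complex) powi m) = 1"
  by (simp add: norm_power_int)

text \<open>\<open>A\<close> is meant to hold the indices singular at \<open>z0\<close>. Indices far
  out are holomorphic on a unit ball and dominated there by a multiple of 1/m^2, so the M-test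
  applies; the finitely many remaining ones are analytic at \<open>z0\<close> by hypothesis.\<close>

lemma Gamma_summand_tail:
  fixes z0 :: complex
  assumes \<epsilon>: "\<epsilon> > 1" and fin: "finite A"
    and an: "\<And>m. m \<notin> A \<Longrightarrow> Gamma_summand \<epsilon> m analytic_on {z0}"
  shows "eventually (\<lambda>s. (\<lambda>m. Gamma_summand \<epsilon> m s) summable_on - A) (nhds z0)"
    and "(\<lambda>s. \<Sum>\<^sub>\<infinity>m\<in>- A. Gamma_summand \<epsilon> m s) analytic_on {z0}"
proof -
  define c where "c = pi / (2 * ln \<epsilon>)"
  have c: "c > 0" using \<epsilon> by (simp add: c_def)
  \<comment> \<open>A bound for the norm on the closed unit ball around \<open>z0\<close>.\<close>
  define R where "R = norm z0 + 1"
  obtain C where C: "C \<ge> 0"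
    "\<And>s y. \<lbrakk>norm s \<le> R; \<bar>y\<bar> \<ge> R + 2\<rbrakk> \<Longrightarrow> norm (Gamma_pair y s) \<le> C / y\<^sup>2"
    using Gamma_pair_bound by metis
  \<comment> \<open>Beyond \<open>M\<close> the imaginary shift c m exceeds R + 2, as the decay
    estimate demands.\<close>
  define M where "M = \<lceil>(R + 2) / c\<rceil>"
  define B where "B = {-M..M} - A"
  define X where "X = - (A \<union> {-M..M})"
  have disj: "X \<inter> B = {}" "X \<union> B = - A" by (auto simp: X_def B_def)
  have Xbig: "\<bar>c * of_int m\<bar> \<ge> R + 2" if "m \<in> X" for m
  proof -
    have "\<bar>real_of_int m\<bar> \<ge> of_int M" using that by (auto simp: X_def)
    then have "\<bar>real_of_int m\<bar> \<ge> (R + 2) / c" unfolding M_def by linarith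
    then show ?thesis using c by (simp add: abs_mult field_simps)
  qed
  have arg: "pi * of_int m / (2 * ln \<epsilon>) = c * of_int m" for m by (simp add: c_def)
  have inR: "norm s \<le> R" if "s \<in> cball z0 1" for s
    using that norm_triangle_ineq2[of s z0] by (simp add: R_def dist_norm norm_minus_commute)
  have bound: "norm (Gamma_summand \<epsilon> m s) \<le> C / c\<^sup>2 * (1 / (of_int m)\<^sup>2)"
    if "m \<in> X" "s \<in> cball z0 1" for m s
    using C(2)[OF inR[OF that(2)] Xbig[OF that(1)]]
    by (simp add: Gamma_summand_eq arg norm_mult norm_powi_minus_one power_mult_distrib)
  have sm: "(\<lambda>m. C / c\<^sup>2 * (1 / (of_int m)\<^sup>2)) summable_on X"
    by (intro summable_on_cmult_right summable_on_inverse_square_int)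
  have sumX: "(\<lambda>m. Gamma_summand \<epsilon> m s) summable_on X" if "s \<in> cball z0 1" for s
    by (rule abs_summable_summable[OF Infinite_Sum.abs_summable_on_comparison_test'[OF sm bound]]) (use that in auto)
  have ul: "uniform_limit (cball z0 1) (\<lambda>F s. \<Sum>m\<in>F. Gamma_summand \<epsilon> m s)
      (\<lambda>s. \<Sum>\<^sub>\<infinity>m\<in>X. Gamma_summand \<epsilon> m s) (finite_subsets_at_top X)"
    by (rule Weierstrass_m_test_general[OF bound sm])
  have hol: "Gamma_summand \<epsilon> m holomorphic_on cball z0 1" if m: "m \<in> X" for m
  proof -
    have "Gamma_summand \<epsilon> m analytic_on {s}" if s: "s \<in> cball z0 1" for s
    proof -
      have "\<bar>Im s\<bar> \<le> R" using inR[OF s] abs_Im_le_cmod[of s] by linarith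
      \<comment> \<open>The imaginary part of s/2 cannot cancel the shift, so both Gamma arguments
        stay off the real axis.\<close>
      then have "\<bar>Im s / 2\<bar> < \<bar>c * of_int m\<bar>" using Xbig[OF m] norm_ge_zero[of z0] unfolding R_def by linarith
      then have "Gamma_pair (c * of_int m) analytic_on {s}"
        by (intro Gamma_pair_analytic not_nonpos_Ints_complex) auto
      then show ?thesis unfolding Gamma_summand_eq[abs_def] arg by (intro analytic_intros) auto
    qed
    then show ?thesis using analytic_on_analytic_at analytic_imp_holomorphic by blast
  qed
  have ev: "eventually (\<lambda>F. continuous_on (cball z0 1) (\<lambda>s. \<Sum>m\<in>F. Gamma_summand \<epsilon> m s) \<and>
      (\<lambda>s. \<Sum>m\<in>F. Gamma_summand \<epsilon> m s) holomorphic_on ball z0 1) (finite_subsets_at_top X)"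
  proof (rule eventually_finite_subsets_at_top_weakI)
    fix F assume F: "finite F" "F \<subseteq> X"
    then have "(\<lambda>s. \<Sum>m\<in>F. Gamma_summand \<epsilon> m s) holomorphic_on cball z0 1"
      using hol by (intro holomorphic_on_sum) auto
    then show "continuous_on (cball z0 1) (\<lambda>s. \<Sum>m\<in>F. Gamma_summand \<epsilon> m s) \<and>
      (\<lambda>s. \<Sum>m\<in>F. Gamma_summand \<epsilon> m s) holomorphic_on ball z0 1"
      using holomorphic_on_imp_continuous_on holomorphic_on_subset ball_subset_cball by blast
  qed
  have "(\<lambda>s. \<Sum>\<^sub>\<infinity>m\<in>X. Gamma_summand \<epsilon> m s) holomorphic_on ball z0 1"
    by (rule holomorphic_uniform_limit[OF ev ul]) auto
  then have anX: "(\<lambda>s. \<Sum>\<^sub>\<infinity>m\<in>X. Gamma_summand \<epsilon> m s) analytic_on {z0}"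
    by (rule analytic_on_subset[OF analytic_on_open[THEN iffD2, rotated]]) auto
  have fB: "finite B" by (simp add: B_def)
  have sumA: "(\<lambda>m. Gamma_summand \<epsilon> m s) summable_on - A" if "s \<in> cball z0 1" for s
    unfolding disj(2)[symmetric] using sumX[OF that] fB disj(1) by (intro summable_on_Un_disjoint) auto
  have evb: "eventually (\<lambda>s. s \<in> cball z0 1) (nhds z0)"
    by (rule eventually_mono[OF eventually_nhds_in_open[of "ball z0 1" z0]]) auto
  show "eventually (\<lambda>s. (\<lambda>m. Gamma_summand \<epsilon> m s) summable_on - A) (nhds z0)"
    using evb by eventually_elim (rule sumA)
  have eq: "eventually (\<lambda>s. (\<Sum>\<^sub>\<infinity>m\<in>- A. Gamma_summand \<epsilon> m s) =
     (\<Sum>\<^sub>\<infinity>m\<in>X. Gamma_summand \<epsilon> m s) + (\<Sum>m\<in>B. Gamma_summand \<epsilon> m s)) (nhds z0)"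
    using evb
  proof eventually_elim
    case (elim s)
    show ?case
      unfolding disj(2)[symmetric] using sumX[OF elim] fB disj(1)
      by (subst infsum_Un_disjoint) auto
  qed
  have "(\<lambda>s. (\<Sum>\<^sub>\<infinity>m\<in>X. Gamma_summand \<epsilon> m s) + (\<Sum>m\<in>B. Gamma_summand \<epsilon> m s)) analytic_on {z0}"
    using an by (intro analytic_intros anX) (auto simp: B_def)
  then show "(\<lambda>s. \<Sum>\<^sub>\<infinity>m\<in>- A. Gamma_summand \<epsilon> m s) analytic_on {z0}"
    using analytic_at_cong[OF eq refl] by blast
qed

section \<open>Local behaviour of the summands\<close>

text \<open>The functional equation, used k+1 times, isolates the factor z + k. That
  \<open>\<psi>\<close> also stays nonzero nearby allows the same form to be inverted for
  1/Gamma.\<close>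

lemma Gamma_local_pole:
  obtains \<psi> :: "complex \<Rightarrow> complex"
  where "\<psi> analytic_on {- of_nat k}" "\<psi> (- of_nat k) \<noteq> 0"
    "eventually (\<lambda>z. \<psi> z \<noteq> 0 \<and> Gamma z = \<psi> z / (z + of_nat k)) (at (- of_nat k))"
proof -
  define \<psi> :: "complex \<Rightarrow> complex" where "\<psi> z = Gamma (z + of_nat (Suc k)) / pochhammer z k" for z
  have p: "pochhammer (- of_nat k :: complex) k \<noteq> 0"
    by (auto simp: pochhammer_eq_0_iff)
  have an: "\<psi> analytic_on {- of_nat k}"
    unfolding \<psi>_def pochhammer_prod using p
    by (intro analytic_intros) (auto simp: pochhammer_prod)
  have nz: "\<psi> (- of_nat k) \<noteq> 0" using p by (simp add: \<psi>_def)
  have "eventually (\<lambda>z. z \<notin> \<int>\<^sub>\<le>\<^sub>0 \<and> \<psi> z \<noteq> 0) (at (- of_nat k :: complex))"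
  proof (rule eventually_conj)
    \<comment> \<open>The other nonpositive integers form a closed set, so a neighbourhood of -k
      avoids them.\<close>
    have "eventually (\<lambda>z. z \<in> - (\<int>\<^sub>\<le>\<^sub>0 - {- of_nat k :: complex})) (nhds (- of_nat k))"
      using nonpos_Ints_subset_Ints by (intro eventually_nhds_in_open open_Compl closed_subset_Ints) auto
    then show "eventually (\<lambda>z. z \<notin> \<int>\<^sub>\<le>\<^sub>0) (at (- of_nat k :: complex))"
      by (auto simp: eventually_at_filter elim!: eventually_mono)
    show "eventually (\<lambda>z. \<psi> z \<noteq> 0) (at (- of_nat k))"
      using analytic_at_neq_imp_eventually_neq[OF an nz] .
  qed
  then have "eventually (\<lambda>z. \<psi> z \<noteq> 0 \<and> Gamma z = \<psi> z / (z + of_nat k)) (at (- of_nat k))"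
  proof eventually_elim
    case (elim z)
    have "Gamma z \<noteq> 0" "z + of_nat k \<noteq> 0"
      using elim by (auto simp: Gamma_eq_zero_iff add_eq_0_iff2)
    moreover have "Gamma (z + of_nat (Suc k)) = Gamma z * (pochhammer z k * (z + of_nat k))"
      using pochhammer_Gamma[of z "Suc k"] elim \<open>Gamma z \<noteq> 0\<close> by (simp add: pochhammer_Suc)
    moreover have "pochhammer z k \<noteq> 0" using elim by (auto simp: \<psi>_def)
    ultimately show ?case using elim by (simp add: \<psi>_def del: of_nat_Suc)
  qed
  then show ?thesis using an nz that by blast
qed

lemma simple_poleI:
  assumes g: "g analytic_on {z}" "g z \<noteq> 0" and f: "eventually (\<lambda>w. f w = g w / (w - z)) (at z)"
  shows "is_pole f z" "zorder f z = -1" "f meromorphic_on {z}"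
proof -
  obtain S where S: "open S" "z \<in> S" "g holomorphic_on S"
    using g(1) by (auto simp: analytic_at)
  obtain T where T: "open T" "z \<in> T" "\<And>w. w \<in> T \<Longrightarrow> w \<noteq> z \<Longrightarrow> f w = g w / (w - z)"
    using f unfolding eventually_at_topological by blast
  have h: "g holomorphic_on S \<inter> T" using S by (rule_tac holomorphic_on_subset) auto
  show "zorder f z = -1"
    by (rule zorder_eqI[of "S \<inter> T" z g]) (use S T h g in \<open>auto simp: power_int_minus field_simps\<close>)
  have "is_pole (\<lambda>w. g w / (w - z) ^ 1) z"
    by (rule is_pole_basic[of g "S \<inter> T"]) (use S T h g in auto)
  then show "is_pole f z"
    using is_pole_cong[OF f refl] by simp
  have "(\<lambda>w. g w / (w - z)) meromorphic_on {z}"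
    using g(1) by (intro meromorphic_intros analytic_on_imp_meromorphic_on) auto
  then show "f meromorphic_on {z}"
    using meromorphic_on_cong[of "{z}" f "\<lambda>w. g w / (w - z)" "{z}"] f by auto
qed

text \<open>If a Gamma argument were -n, solving for s would give a point of
  \<open>pole_set\<close>, with index -m for the plus sign and m for the minus sign.\<close>

lemma Gamma_summand_analytic:
  assumes "\<epsilon> > 1" "s \<notin> pole_set \<epsilon>"
  shows "Gamma_summand \<epsilon> m analytic_on {s}"
proof -
  let ?y = "pi * of_int m / (2 * ln \<epsilon>)"
  have "s / 2 + \<i> * of_real ?y \<notin> \<int>\<^sub>\<le>\<^sub>0"
  proof
    assume "s / 2 + \<i> * of_real ?y \<in> \<int>\<^sub>\<le>\<^sub>0"
    then obtain n where "s / 2 + \<i> * of_real ?y = - of_nat n" by (elim nonpos_Ints_cases') 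
    then have "s / 2 = - of_nat n - \<i> * of_real ?y" by (simp only: eq_diff_eq)
    then have "2 * (s / 2) = 2 * (- of_nat n - \<i> * of_real ?y)" by (simp only:)
    then have "s = - 2 * of_nat n + of_real pi * \<i> * of_int (- m) / of_real (ln \<epsilon>)"
      by (simp add: algebra_simps)
    then show False using assms unfolding pole_set_def by blast
  qed
  moreover have "s / 2 - \<i> * of_real ?y \<notin> \<int>\<^sub>\<le>\<^sub>0"
  proof
    assume "s / 2 - \<i> * of_real ?y \<in> \<int>\<^sub>\<le>\<^sub>0"
    then obtain n where "s / 2 - \<i> * of_real ?y = - of_nat n" by (elim nonpos_Ints_cases')
    then have "s / 2 = - of_nat n + \<i> * of_real ?y" by (simp only: diff_eq_eq)
    then have "2 * (s / 2) = 2 * (- of_nat n + \<i> * of_real ?y)" by (simp only:)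
    then have "s = - 2 * of_nat n + of_real pi * \<i> * of_int m / of_real (ln \<epsilon>)"
      by (simp add: algebra_simps)
    then show False using assms unfolding pole_set_def by blast
  qed
  ultimately show ?thesis
    unfolding Gamma_summand_eq[abs_def] by (intro analytic_intros Gamma_pair_analytic) auto
qed

context
  fixes \<epsilon> :: real and k :: nat and m0 :: int and s0 :: complex
  assumes \<epsilon>: "\<epsilon> > 1"
    and s0: "s0 = - 2 * of_nat k + of_real pi * \<i> * of_int m0 / of_real (ln \<epsilon>)"
begin

text \<open>At \<open>s0\<close> the two arguments have imaginary parts proportional to m0 + m and
  m0 - m, so neither is real.\<close>

lemma Gamma_summand_analytic_other:
  assumes m: "m \<noteq> m0" "m \<noteq> - m0"
  shows "Gamma_summand \<epsilon> m analytic_on {s0}"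
proof -
  let ?y = "pi * of_int m / (2 * ln \<epsilon>)"
  have L: "ln \<epsilon> > 0" using \<epsilon> by simp
  have "Im (s0 / 2 + \<i> * of_real ?y) = pi / (2 * ln \<epsilon>) * of_int (m0 + m)"
       "Im (s0 / 2 - \<i> * of_real ?y) = pi / (2 * ln \<epsilon>) * of_int (m0 - m)"
    unfolding s0 using L by (simp_all add: field_simps)
  moreover have "real_of_int (m0 + m) \<noteq> 0" "real_of_int (m0 - m) \<noteq> 0"
    unfolding of_int_eq_0_iff using m by auto
  ultimately have "Im (s0 / 2 + \<i> * of_real ?y) \<noteq> 0" "Im (s0 / 2 - \<i> * of_real ?y) \<noteq> 0"
    using L by (simp_all only: mult_eq_0_iff divide_eq_0_iff, simp_all)
  then show ?thesis
    unfolding Gamma_summand_eq[abs_def]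
    by (intro analytic_intros Gamma_pair_analytic not_nonpos_Ints_complex disjI1) auto
qed

text \<open>For the index \<open>m0\<close> the argument with the minus sign hits the pole -k, while
  the other is nonreal unless \<open>m0\<close> is 0.\<close>

lemma Gamma_factors:
  defines "y \<equiv> complex_of_real (pi * of_int m0 / (2 * ln \<epsilon>))"
  shows "s0 / 2 - \<i> * y = - of_nat k"
    and "m0 \<noteq> 0 \<Longrightarrow> s0 / 2 + \<i> * y \<notin> \<int>\<^sub>\<le>\<^sub>0"
    and "m0 \<noteq> 0 \<Longrightarrow> s0 \<notin> \<int>\<^sub>\<le>\<^sub>0"
    and "filterlim (\<lambda>s. s / 2 - \<i> * y) (at (- of_nat k)) (at s0)"
    and "s / 2 - \<i> * y + of_nat k = (s - s0) / 2"
proof -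
  have L: "ln \<epsilon> > 0" using \<epsilon> by simp
  show 1: "s0 / 2 - \<i> * y = - of_nat k"
    unfolding s0 y_def by (simp add: field_simps)
  then have "s0 / 2 = \<i> * y - of_nat k" by (simp add: diff_eq_eq)
  then show 2: "s / 2 - \<i> * y + of_nat k = (s - s0) / 2" for s
    by (simp add: diff_divide_distrib)
  have "Im (s0 / 2 + \<i> * y) = pi * of_int m0 / ln \<epsilon>" "Im s0 = pi * of_int m0 / ln \<epsilon>"
    unfolding s0 y_def by (simp_all add: field_simps)
  then show "m0 \<noteq> 0 \<Longrightarrow> s0 / 2 + \<i> * y \<notin> \<int>\<^sub>\<le>\<^sub>0" "m0 \<noteq> 0 \<Longrightarrow> s0 \<notin> \<int>\<^sub>\<le>\<^sub>0"
    using L by (intro not_nonpos_Ints_complex disjI1, simp)+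
  show "filterlim (\<lambda>s. s / 2 - \<i> * y) (at (- of_nat k)) (at s0)"
  proof (rule filterlim_atI)
    show "((\<lambda>s. s / 2 - \<i> * y) \<longlongrightarrow> - of_nat k) (at s0)"
      unfolding 1[symmetric] by (intro tendsto_intros) auto
    show "eventually (\<lambda>s. s / 2 - \<i> * y \<noteq> - of_nat k) (at s0)"
      unfolding 1[symmetric] by (auto simp: eventually_at_filter)
  qed
qed

text \<open>Ensures that avoiding the poles of all summands means avoiding \<open>pole_set\<close>.
  For index 0 both factors blow up; otherwise the second one is analytic and nonzero.\<close>

lemma is_pole_Gamma_summand: "is_pole (Gamma_summand \<epsilon> m0) s0"
proof -
  let ?y = "pi * of_int m0 / (2 * ln \<epsilon>)"
  have p: "is_pole (\<lambda>s. Gamma (s / 2 - \<i> * of_real ?y)) s0"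
    unfolding is_pole_def
    by (rule filterlim_compose[OF is_pole_Gamma[unfolded is_pole_def] Gamma_factors(4)])
  show ?thesis
  proof (cases "m0 = 0")
    case True
    have "is_pole (\<lambda>s. Gamma (s / 2) * Gamma (s / 2)) s0"
      using p True unfolding is_pole_def by (intro filterlim_at_infinity_times) simp_all
    then show ?thesis using True by (simp add: Gamma_summand_def[abs_def])
  next
    case False
    have "(\<lambda>s. (-1) powi m0 * Gamma (s / 2 + \<i> * of_real ?y)) analytic_on {s0}"
      using Gamma_factors(2)[OF False] by (intro analytic_intros) auto
    from is_pole_mult_analytic_nonzero1[OF p this] show ?thesis
      using Gamma_factors(2)[OF False]
      by (simp add: Gamma_summand_eq[abs_def] Gamma_pair_def Gamma_eq_zero_iff mult.assoc)
  qed
qed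

end

lemma Gamma_summand_minus: "Gamma_summand \<epsilon> (- m) s = Gamma_summand \<epsilon> m s"
  by (simp add: Gamma_summand_def power_int_minus_one_minus mult_ac)

section \<open>The formula as a meromorphic function\<close>

text \<open>The entire, zero-free part of the prefactor; \<open>rGamma\<close> is kept apart since
  its zeros lower the pole order for index 0.\<close>

definition Gamma_prefactor :: "int \<Rightarrow> real \<Rightarrow> complex \<Rightarrow> complex" where
  "Gamma_prefactor D \<epsilon> s = of_int (quad_disc D) powr (s / 2) / (8 * of_real (ln \<epsilon>))"

lemma Gamma_prefactor_props:
  assumes "D > 1" "\<epsilon> > 1"
  shows "Gamma_prefactor D \<epsilon> analytic_on A" "Gamma_prefactor D \<epsilon> s \<noteq> 0"
proof -
  have q: "complex_of_int (quad_disc D) \<noteq> 0" using assms by (simp add: quad_disc_def)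
  have L: "complex_of_real (ln \<epsilon>) \<noteq> 0" using assms by simp
  define l where "l = Ln (of_int (quad_disc D))"
  have eq: "Gamma_prefactor D \<epsilon> = (\<lambda>s. exp (s / 2 * l) / (8 * of_real (ln \<epsilon>)))"
    using q by (simp add: fun_eq_iff Gamma_prefactor_def powr_def l_def)
  show "Gamma_prefactor D \<epsilon> analytic_on A"
    unfolding eq using L by (intro analytic_intros) simp_all
  show "Gamma_prefactor D \<epsilon> s \<noteq> 0"
    unfolding eq using L by simp
qed

lemma Gamma_formula_eq:
  "Gamma_formula D \<epsilon> s = Gamma_prefactor D \<epsilon> s * rGamma s * (\<Sum>\<^sub>\<infinity>m\<in>UNIV. Gamma_summand \<epsilon> m s)"
  by (simp add: Gamma_formula_def Gamma_prefactor_def)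

lemma Gamma_summand_summable:
  assumes "\<epsilon> > 1" "s \<notin> pole_set \<epsilon>"
  shows "(\<lambda>m. Gamma_summand \<epsilon> m s) summable_on UNIV"
  using eventually_nhds_x_imp_x[OF Gamma_summand_tail(1)[OF assms(1), of "{}" s]]
    Gamma_summand_analytic[OF assms] by simp

lemma Gamma_formula_analytic:
  assumes "D > 1" "\<epsilon> > 1" "s \<notin> pole_set \<epsilon>"
  shows "Gamma_formula D \<epsilon> analytic_on {s}"
proof -
  have "(\<lambda>s. \<Sum>\<^sub>\<infinity>m\<in>UNIV. Gamma_summand \<epsilon> m s) analytic_on {s}"
    using Gamma_summand_tail(2)[OF assms(2), of "{}" s] Gamma_summand_analytic[OF assms(2,3)] by simp
  then show ?thesis
    unfolding Gamma_formula_eq[abs_def]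
    by (intro analytic_intros Gamma_prefactor_props assms analytic_rGamma)
qed

lemma Gamma_formula_split:
  assumes \<epsilon>: "\<epsilon> > 1" and A: "finite A"
    and an: "\<And>m. m \<notin> A \<Longrightarrow> Gamma_summand \<epsilon> m analytic_on {s0}"
  shows "eventually (\<lambda>s. Gamma_formula D \<epsilon> s = Gamma_prefactor D \<epsilon> s * rGamma s *
    ((\<Sum>m\<in>A. Gamma_summand \<epsilon> m s) + (\<Sum>\<^sub>\<infinity>m\<in>- A. Gamma_summand \<epsilon> m s))) (at s0)"
proof -
  have "eventually (\<lambda>s. (\<lambda>m. Gamma_summand \<epsilon> m s) summable_on - A) (at s0)"
    using Gamma_summand_tail(1)[OF \<epsilon> A an] by (auto simp: eventually_at_filter elim: eventually_mono)
  then show ?thesis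
  proof eventually_elim
    case (elim s)
    have "(\<Sum>\<^sub>\<infinity>m\<in>A \<union> - A. Gamma_summand \<epsilon> m s) =
        (\<Sum>m\<in>A. Gamma_summand \<epsilon> m s) + (\<Sum>\<^sub>\<infinity>m\<in>- A. Gamma_summand \<epsilon> m s)"
      using A elim by (subst infsum_Un_disjoint) auto
    then show ?case by (simp add: Gamma_formula_eq)
  qed
qed

text \<open>Everything except the indices \<open>m0\<close> and \<open>- m0\<close> is analytic at
  \<open>s0\<close> and, after multiplication by s - s0, does not contribute to g(s0). The value
  g(s0) therefore comes from the singular summands alone.\<close>

lemma Gamma_formula_pole:
  assumes D: "D > 1" and \<epsilon>: "\<epsilon> > 1"
    and s0: "s0 = - 2 * of_nat k + of_real pi * \<i> * of_int m0 / of_real (ln \<epsilon>)"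
  obtains g where "g analytic_on {s0}" "g s0 \<noteq> 0"
    "eventually (\<lambda>s. Gamma_formula D \<epsilon> s = g s / (s - s0)) (at s0)"
proof -
  let ?P = "Gamma_prefactor D \<epsilon>"
  define y where "y = complex_of_real (pi * of_int m0 / (2 * ln \<epsilon>))"
  \<comment> \<open>For \<open>m0 = 0\<close> this set has a single element, so the doubling of
    summands occurs only in the other case.\<close>
  define A where "A = {m0, - m0}"
  define rest where "rest s = (\<Sum>\<^sub>\<infinity>m\<in>- A. Gamma_summand \<epsilon> m s)" for s
  note y = Gamma_factors[OF \<epsilon> s0, folded y_def]
  have other: "Gamma_summand \<epsilon> m analytic_on {s0}" if "m \<notin> A" for m
    using that Gamma_summand_analytic_other[OF \<epsilon> s0] by (auto simp: A_def)
  have fin: "finite A" by (simp add: A_def)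
  have rest: "rest analytic_on {s0}"
    unfolding rest_def by (rule Gamma_summand_tail(2)[OF \<epsilon> fin other])
  have split: "eventually (\<lambda>s. Gamma_formula D \<epsilon> s =
      ?P s * rGamma s * ((\<Sum>m\<in>A. Gamma_summand \<epsilon> m s) + rest s)) (at s0)"
    unfolding rest_def by (rule Gamma_formula_split[OF \<epsilon> fin other])
  obtain \<psi> where \<psi>: "\<psi> analytic_on {- of_nat k}" "\<psi> (- of_nat k) \<noteq> 0"
    "eventually (\<lambda>z. \<psi> z \<noteq> 0 \<and> Gamma z = \<psi> z / (z + of_nat k)) (at (- of_nat k))"
    using Gamma_local_pole .
  have ev\<psi>: "eventually (\<lambda>s. Gamma (s / 2 - \<i> * y) = 2 * \<psi> (s / 2 - \<i> * y) / (s - s0)) (at s0)"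
    using eventually_compose_filterlim[OF \<psi>(3) y(4)] by eventually_elim (simp add: y(5))
  have "\<psi> \<circ> (\<lambda>s. s / 2 - \<i> * y) analytic_on {s0}"
    by (rule analytic_on_compose_gen[OF _ \<psi>(1)]) (auto intro!: analytic_intros simp: y(1))
  then have an\<psi>: "(\<lambda>s. \<psi> (s / 2 - \<i> * y)) analytic_on {s0}" by (simp add: o_def)
  have ne: "eventually (\<lambda>s. s \<noteq> s0) (at s0)" by (auto simp: eventually_at_filter)
  note P = Gamma_prefactor_props[OF D \<epsilon>]
  show ?thesis
  proof (cases "m0 = 0")
    case False
    define \<sigma> where "\<sigma> = (-1 :: complex) powi m0"
    \<comment> \<open>The factor 4 is 2 for the equal summands \<open>m0\<close> and
      \<open>- m0\<close>, times 2 because the Gamma argument contains s/2.\<close>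
    define g where "g s = ?P s * rGamma s * (4 * \<sigma> * Gamma (s / 2 + \<i> * y) * \<psi> (s / 2 - \<i> * y) + (s - s0) * rest s)" for s
    have "g analytic_on {s0}"
      unfolding g_def using y(2)[OF False]
      by (intro analytic_intros P an\<psi> rest analytic_rGamma) auto
    moreover have "g s0 \<noteq> 0"
      using P(2) y(1) y(2,3)[OF False] \<psi>(2)
      by (simp add: g_def rGamma_eq_zero_iff Gamma_eq_zero_iff \<sigma>_def)
    moreover have "eventually (\<lambda>s. Gamma_formula D \<epsilon> s = g s / (s - s0)) (at s0)"
      using split ev\<psi> ne
    proof eventually_elim
      case (elim s)
      have "(\<Sum>m\<in>A. Gamma_summand \<epsilon> m s) = 2 * Gamma_summand \<epsilon> m0 s"
        using False by (simp add: A_def Gamma_summand_minus)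
      also have "Gamma_summand \<epsilon> m0 s = \<sigma> * (Gamma (s / 2 + \<i> * y) * (2 * \<psi> (s / 2 - \<i> * y) / (s - s0)))"
        by (simp only: Gamma_summand_eq Gamma_pair_def \<sigma>_def flip: elim(2) y_def)
      finally have *: "(\<Sum>m\<in>A. Gamma_summand \<epsilon> m s) =
          4 * \<sigma> * Gamma (s / 2 + \<i> * y) * \<psi> (s / 2 - \<i> * y) / (s - s0)" by simp
      have "a * (t / d + r) = a * (t + d * r) / d" if "d \<noteq> 0" for a t d r :: complex
        using that by (simp add: field_simps)
      from this[of "s - s0"] show ?case unfolding elim(1) * g_def using elim(3) by simp
    qed
    ultimately show ?thesis by (rule that)
  next
    case True
    have y0: "y = 0" and s0': "s0 = - of_nat (2 * k)" using True s0 by (simp_all add: y_def)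
    obtain \<phi> where \<phi>': "\<phi> analytic_on {- of_nat (2 * k)}" "\<phi> (- of_nat (2 * k)) \<noteq> 0"
      "eventually (\<lambda>z. \<phi> z \<noteq> 0 \<and> Gamma z = \<phi> z / (z + of_nat (2 * k))) (at (- of_nat (2 * k)))"
      by (rule Gamma_local_pole)
    note \<phi> = \<phi>'[folded s0']
    \<comment> \<open>Gamma(s/2)^2 has leading factor 4 / (s - s0)^2, and 1/Gamma(s) = (s - s0) /
      \<open>\<phi>\<close> s removes one order.\<close>
    define g where "g s = ?P s * (4 * (\<psi> (s / 2 - \<i> * y))\<^sup>2 / \<phi> s + (s - s0) * (rGamma s * rest s))" for s
    have "g analytic_on {s0}"
      unfolding g_def using \<phi> by (intro analytic_intros P an\<psi> rest analytic_rGamma) auto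
    moreover have "g s0 \<noteq> 0"
      using P(2) y(1) \<phi>(2) \<psi>(2) by (simp add: g_def)
    moreover have "eventually (\<lambda>s. Gamma_formula D \<epsilon> s = g s / (s - s0)) (at s0)"
      using split ev\<psi> \<phi>(3) ne
    proof eventually_elim
      case (elim s)
      have 1: "(\<Sum>m\<in>A. Gamma_summand \<epsilon> m s) = (2 * \<psi> (s / 2 - \<i> * y) / (s - s0))\<^sup>2"
        unfolding elim(2)[symmetric] using True y0
        by (simp add: A_def Gamma_summand_def power2_eq_square)
      have 2: "rGamma s = (s - s0) / \<phi> s"
        using elim(3) by (simp add: rGamma_inverse_Gamma s0')
      have 3: "p * (d / f) * ((2 * x / d)\<^sup>2 + r) = p * (4 * x\<^sup>2 / f + d * (d / f * r)) / d"
        if "d \<noteq> 0" "f \<noteq> 0" for p d f x r :: complex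
      proof -
        have "p * (d / f) * ((2 * x / d)\<^sup>2 + r) = p / f * (4 * x\<^sup>2 / d + d * r)"
          using that by (simp add: power2_eq_square distrib_left)
        also have "\<dots> = p * (4 * x\<^sup>2 / f + d * (d / f * r)) / d"
          using that by (simp add: distrib_left add_divide_distrib)
        finally show ?thesis .
      qed
      show ?case unfolding elim(1) 1 2 g_def by (rule 3) (use elim(3,4) in auto)
    qed
    ultimately show ?thesis by (rule that)
  qed
qed

section \<open>Arithmetic of the quadratic field\<close>

text \<open>In lowest terms D n^2 = m^2 forces n^2 = 1, so D would be a perfect square greater than
  1.\<close>

lemma sqrt_squarefree_irrational:
  fixes D :: int
  assumes D: "D > 1" "squarefree D"
  shows "sqrt (of_int D) \<notin> \<rat>"
proof
  assume "sqrt (of_int D) \<in> \<rat>"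
  then obtain m n :: nat where mn: "n \<noteq> 0" "\<bar>sqrt (of_int D)\<bar> = real m / real n" "coprime m n"
    by (rule Rats_abs_nat_div_natE)
  have "of_int D = \<bar>sqrt (of_int D)\<bar>\<^sup>2" using D by simp
  also have "\<dots> = (real m)\<^sup>2 / (real n)\<^sup>2" using mn by (simp add: power_divide)
  finally have "of_int D * (real n)\<^sup>2 = (real m)\<^sup>2" using mn by (simp add: field_simps)
  then have "real_of_int (D * (int n)\<^sup>2) = real_of_int ((int m)\<^sup>2)" by simp
  then have eq: "D * (int n)\<^sup>2 = (int m)\<^sup>2" by (simp only: of_int_eq_iff)
  then have "(int n)\<^sup>2 dvd (int m)\<^sup>2" by (simp flip: eq)
  moreover have "coprime ((int n)\<^sup>2) ((int m)\<^sup>2)" using mn by (simp add: coprime_commute)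
  ultimately have "is_unit ((int n)\<^sup>2)" by (simp add: coprime_absorb_left)
  then have "(int n)\<^sup>2 = 1" by simp
  with eq have "(int m)\<^sup>2 = D" by simp
  then have "int m dvd 1" using D squarefreeD[of D "int m"] by simp
  then show False using \<open>(int m)\<^sup>2 = D\<close> D by simp
qed

text \<open>Irrationality of sqrt(D) makes the rational coordinates unique, so the definite
  description is determined.\<close>

lemma quad_conj_eq:
  assumes D: "D > 1" "squarefree D" and ab: "a \<in> \<rat>" "b \<in> \<rat>"
  shows "quad_conj D (a + b * sqrt (of_int D)) = a - b * sqrt (of_int D)"
proof -
  have uniq: "a' = a \<and> b' = b"
    if "a' \<in> \<rat>" "b' \<in> \<rat>" "a + b * sqrt (of_int D) = a' + b' * sqrt (of_int D)" for a' b'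
  proof -
    have eq: "(b' - b) * sqrt (of_int D) = a - a'" using that by (simp add: algebra_simps)
    have "b' = b"
    proof (rule ccontr)
      assume "b' \<noteq> b"
      with eq have "sqrt (of_int D) = (a - a') / (b' - b)" by (simp add: field_simps)
      also have "\<dots> \<in> \<rat>" using that ab by (intro Rats_divide Rats_diff)
      finally show False using sqrt_squarefree_irrational[OF D] by contradiction
    qed
    with eq show ?thesis by simp
  qed
  show ?thesis
    unfolding quad_conj_def
  proof (rule the_equality)
    show "\<exists>a'\<in>\<rat>. \<exists>b'\<in>\<rat>. a + b * sqrt (of_int D) = a' + b' * sqrt (of_int D) \<and>
        a - b * sqrt (of_int D) = a' - b' * sqrt (of_int D)"
      using ab by blast
    show "y = a - b * sqrt (of_int D)"
      if "\<exists>a'\<in>\<rat>. \<exists>b'\<in>\<rat>. a + b * sqrt (of_int D) = a' + b' * sqrt (of_int D) \<and>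
        y = a' - b' * sqrt (of_int D)" for y
      using that uniq by blast
  qed
qed

text \<open>Conjugation respects powers but changes the sign of sqrt(q), so the trace becomes a
  difference.\<close>

lemma F_D_eq:
  assumes D: "D > 1" "squarefree D" and \<epsilon>: "\<epsilon> \<in> quad_field D"
  shows "F_D D \<epsilon> n = (\<epsilon> ^ n - quad_conj D \<epsilon> ^ n) / sqrt (of_int (quad_disc D))"
proof -
  define w where "w = sqrt (of_int D)"
  have w: "w \<noteq> 0" "w * w = of_int D" using D by (simp_all add: w_def)
  obtain a b where ab: "a \<in> \<rat>" "b \<in> \<rat>" "\<epsilon> = a + b * w"
    using \<epsilon> by (auto simp: quad_field_def w_def)
  have conj: "quad_conj D \<epsilon> = a - b * w"
    unfolding ab(3) w_def by (rule quad_conj_eq[OF D ab(1,2)])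
  have "\<exists>A\<in>\<rat>. \<exists>B\<in>\<rat>. \<epsilon> ^ n = A + B * w \<and> quad_conj D \<epsilon> ^ n = A - B * w"
  proof (induction n)
    case 0
    show ?case by (intro bexI[of _ 1] bexI[of _ 0]) auto
  next
    case (Suc n)
    then obtain A B where AB: "A \<in> \<rat>" "B \<in> \<rat>" "\<epsilon> ^ n = A + B * w" "quad_conj D \<epsilon> ^ n = A - B * w"
      by blast
    have "\<epsilon> ^ Suc n = (a + b * w) * (A + B * w)"
      by (metis AB(3) ab(3) power_Suc)
    moreover have "quad_conj D \<epsilon> ^ Suc n = (a - b * w) * (A - B * w)"
      by (metis AB(4) conj power_Suc)
    moreover have "(a + b * w) * (A + B * w) = (a * A + b * B * of_int D) + (a * B + b * A) * w"
      "(a - b * w) * (A - B * w) = (a * A + b * B * of_int D) - (a * B + b * A) * w"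
      unfolding w(2)[symmetric] by (simp_all add: algebra_simps)
    moreover have "a * A + b * B * of_int D \<in> \<rat>" "a * B + b * A \<in> \<rat>"
      using AB ab by auto
    ultimately show ?case by metis
  qed
  then obtain A B where AB: "A \<in> \<rat>" "B \<in> \<rat>" "\<epsilon> ^ n = A + B * w" "quad_conj D \<epsilon> ^ n = A - B * w"
    by blast
  define c :: real where "c = (if D mod 4 = 1 then 1 else 2)"
  have c: "c \<in> \<rat>" "c \<noteq> 0" by (auto simp: c_def)
  have q: "sqrt (of_int (quad_disc D)) = c * w"
    by (simp add: quad_disc_def c_def w_def real_sqrt_mult)
  \<comment> \<open>Dividing by a rational multiple of sqrt(D) exchanges the roles of the two
    coordinates.\<close>
  have 1: "A / (c * of_int D) * w = A / (c * w)"
    using w(1) by (simp flip: w(2))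
  have 2: "B / c = B * w / (c * w)" using w(1) by simp
  have "\<epsilon> ^ n / (c * w) = B / c + A / (c * of_int D) * w"
    unfolding 1 2 AB(3) by (simp add: add_divide_distrib)
  moreover have "quad_conj D (B / c + A / (c * of_int D) * w) = B / c - A / (c * of_int D) * w"
    unfolding w_def using AB c by (intro quad_conj_eq D) auto
  moreover have "B / c - A / (c * of_int D) * w = - (A - B * w) / (c * w)"
    unfolding 1 2 by (simp add: diff_divide_distrib)
  ultimately show ?thesis
    unfolding F_D_def quad_trace_def q AB(4) by (simp add: diff_divide_distrib)
qed

text \<open>Norm -1 makes the conjugate equal to -1/\<open>\<epsilon>\<close>; an odd power keeps
  this sign, and the difference turns into a sum of reciprocals.\<close>

lemma F_D_odd_eq_cosh:
  assumes D: "D > 1" "squarefree D" and \<epsilon>: "\<epsilon> \<in> quad_field D" "\<epsilon> > 1" "quad_norm D \<epsilon> = -1"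
  shows "F_D D \<epsilon> (2 * Suc n - 1) = 2 * cosh ((2 * real n + 1) * ln \<epsilon>) / sqrt (of_int (quad_disc D))"
proof -
  have "quad_conj D \<epsilon> = - inverse \<epsilon>"
    using \<epsilon> by (simp add: quad_norm_def field_simps)
  then have "quad_conj D \<epsilon> ^ (2 * n + 1) = - inverse (\<epsilon> ^ (2 * n + 1))"
    by (simp add: power_inverse)
  moreover have "(2 * real n + 1) * ln \<epsilon> = ln (\<epsilon> ^ (2 * n + 1))"
    using \<epsilon> by (subst ln_realpow) auto
  moreover have "2 * cosh (ln (\<epsilon> ^ (2 * n + 1))) = \<epsilon> ^ (2 * n + 1) + inverse (\<epsilon> ^ (2 * n + 1))"
    using \<epsilon> by (subst cosh_ln_real) auto
  moreover have "2 * Suc n - 1 = 2 * n + 1" by simp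
  ultimately show ?thesis
    by (simp only: F_D_eq[OF D \<epsilon>(1)] diff_minus_eq_add)
qed

section \<open>The two sides agree\<close>

text \<open>A complex power of a positive real, written with the real logarithm so that each term is
  visibly entire in \<open>s\<close>.\<close>

definition cosh_term :: "real \<Rightarrow> complex \<Rightarrow> nat \<Rightarrow> complex" where
  "cosh_term L s n = exp (- s * of_real (ln (2 * cosh ((2 * real n + 1) * L))))"

lemma cosh_term_of_real: "cosh_term L (of_real x) n = of_real (cosh_powr x ((2 * real n + 1) * L))"
proof -
  have "cosh_term L (of_real x) n = exp (of_real (- x * ln (2 * cosh ((2 * real n + 1) * L))))"
    by (simp add: cosh_term_def)
  also have "\<dots> = of_real (exp (- x * ln (2 * cosh ((2 * real n + 1) * L))))"
    by (rule exp_of_real)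
  finally show ?thesis by (simp add: cosh_powr_def powr_def)
qed

text \<open>The geometric majorant depends on s only through the lower bound for Re s, as locally
  uniform convergence requires.\<close>

lemma norm_cosh_term_le:
  assumes L: "L > 0" and \<delta>: "\<delta> > 0" "Re s \<ge> \<delta>"
  shows "norm (cosh_term L s n) \<le> exp (- (2 * \<delta> * L)) ^ n"
proof -
  have "norm (cosh_term L s n) = cosh_powr (Re s) ((2 * real n + 1) * L)"
    by (simp add: cosh_term_def cosh_powr_def powr_def norm_exp_eq_Re)
  also have "\<dots> \<le> exp (- Re s * ((2 * real n + 1) * L))"
    using \<delta> by (intro cosh_powr_le_exp) auto
  also have "\<dots> \<le> exp (- \<delta> * (2 * real n * L))"
  proof -
    have "\<delta> * (2 * real n * L) \<le> Re s * ((2 * real n + 1) * L)"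
      using L \<delta> by (intro mult_mono) auto
    then show ?thesis by simp
  qed
  also have "\<dots> = exp (- (2 * \<delta> * L)) ^ n"
    by (simp flip: exp_of_nat_mult add: mult_ac)
  finally show ?thesis .
qed

lemma geometric_exp_summable: "summable (\<lambda>n. exp (- (2 * \<delta> * L)) ^ n :: real)" if "L > 0" "\<delta> > 0"
  using that by (intro summable_geometric) auto

lemma cosh_term_has_sum:
  assumes "L > 0" "Re s > 0"
  shows "(cosh_term L s has_sum (\<Sum>n. cosh_term L s n)) UNIV"
proof (rule norm_summable_imp_has_sum)
  show "summable (\<lambda>n. norm (cosh_term L s n))"
    using assms by (intro summable_comparison_test'[OF geometric_exp_summable[of L "Re s"]])
      (auto intro: norm_cosh_term_le)
  then show "cosh_term L s sums (\<Sum>n. cosh_term L s n)"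
    by (rule summable_sums[OF summable_norm_cancel])
qed

lemma cosh_term_suminf_holomorphic:
  assumes L: "L > 0"
  shows "(\<lambda>s. \<Sum>n. cosh_term L s n) holomorphic_on {s. Re s > 0}"
proof (rule holomorphic_uniform_sequence)
  show "open {s. Re s > 0}" by (rule open_halfspace_Re_gt)
  show "(\<lambda>s. \<Sum>n<N. cosh_term L s n) holomorphic_on {s. Re s > 0}" for N
    unfolding cosh_term_def by (intro holomorphic_intros)
  fix s0 :: complex assume s0: "s0 \<in> {s. Re s > 0}"
  \<comment> \<open>On the disc of radius Re s0 / 2 the real part stays at least Re s0 / 2.\<close>
  define d where "d = Re s0 / 2"
  have d: "d > 0" using s0 by (simp add: d_def)
  have re: "Re s \<ge> d" if "s \<in> cball s0 d" for s
    using that abs_Re_le_cmod[of "s0 - s"] by (simp add: dist_norm d_def)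
  show "\<exists>d>0. cball s0 d \<subseteq> {s. 0 < Re s} \<and>
      uniform_limit (cball s0 d) (\<lambda>n x. \<Sum>i<n. cosh_term L x i) (\<lambda>s. \<Sum>n. cosh_term L s n) sequentially"
  proof (intro exI[of _ d] conjI d)
    show "cball s0 d \<subseteq> {s. 0 < Re s}" using re d by fastforce
    show "uniform_limit (cball s0 d) (\<lambda>n x. \<Sum>i<n. cosh_term L x i) (\<lambda>s. \<Sum>n. cosh_term L s n) sequentially"
      by (rule Weierstrass_m_test[OF _ geometric_exp_summable[OF L d]])
         (intro norm_cosh_term_le L d re)
  qed
qed

text \<open>Links the symmetric Fourier limit with the unordered sum: the symmetric intervals
  eventually contain every finite set.\<close>

lemma summable_on_int_symmetric_tendsto:
  fixes f :: "int \<Rightarrow> 'a :: {topological_comm_monoid_add, t2_space}"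
  assumes "f summable_on UNIV"
  shows "(\<lambda>M. \<Sum>m\<in>{- int M..int M}. f m) \<longlonglongrightarrow> (\<Sum>\<^sub>\<infinity>m. f m)"
proof -
  have "(sum f \<longlongrightarrow> (\<Sum>\<^sub>\<infinity>m. f m)) (finite_subsets_at_top UNIV)"
    using assms has_sum_infsum unfolding has_sum_def by blast
  moreover have "filterlim (\<lambda>M. {- int M..int M}) (finite_subsets_at_top UNIV) sequentially"
    unfolding filterlim_finite_subsets_at_top
  proof (intro allI impI)
    fix X :: "int set" assume X: "finite X \<and> X \<subseteq> UNIV"
    define K where "K = nat (Max (insert 0 (abs ` X)))"
    have "\<bar>x\<bar> \<le> int K" if "x \<in> X" for x
      using X that by (simp add: K_def)
    then show "eventually (\<lambda>M. finite {- int M..int M} \<and> X \<subseteq> {- int M..int M} \<and> {- int M..int M} \<subseteq> UNIV) sequentially"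
      by (intro eventually_mono[OF eventually_ge_at_top[of K]]) force
  qed
  ultimately show ?thesis by (rule filterlim_compose)
qed

lemma pole_set_Re: "s \<in> pole_set \<epsilon> \<Longrightarrow> Re s \<le> 0"
  by (auto simp: pole_set_def)

lemma Gamma_formula_real:
  assumes \<epsilon>: "\<epsilon> > 1" and x: "x > 0"
  shows "Gamma_formula D \<epsilon> (of_real x) =
    of_int (quad_disc D) powr (of_real x / 2) * (\<Sum>n. cosh_term (ln \<epsilon>) (of_real x) n)"
proof -
  define L where "L = ln \<epsilon>"
  have L: "L > 0" using \<epsilon> by (simp add: L_def)
  \<comment> \<open>The 8 is 4 from the cosine integral times 2 from the Poisson weight
    1/(2L).\<close>
  let ?c = "rGamma (complex_of_real x) / (8 * of_real L)"
  have nin: "complex_of_real x \<notin> pole_set \<epsilon>" using pole_set_Re[of "of_real x" \<epsilon>] x by auto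
  have "complex_of_real ((if even m then 1 else -1) * cosh_cos_integral x (pi * of_int m / L) / (2 * L)) =
      ?c * Gamma_summand \<epsilon> m (of_real x)" for m
  proof -
    have "(-1 :: complex) powi m = (if even m then 1 else -1)"
      by (simp add: power_int_minus_left)
    then have 1: "Gamma_summand \<epsilon> m (of_real x) = (if even m then 1 else -1) *
        (Gamma (of_real x / 2 + \<i> * of_real (pi * of_int m / L / 2)) * Gamma (of_real x / 2 - \<i> * of_real (pi * of_int m / L / 2)))"
      unfolding Gamma_summand_eq Gamma_pair_def L_def[symmetric] by (simp add: mult.commute)
    have "complex_of_real ((if even m then 1 else -1) * cosh_cos_integral x (pi * of_int m / L) / (2 * L)) =
      (if even m then 1 else -1) * complex_of_real (cosh_cos_integral x (pi * of_int m / L)) / (2 * of_real L)"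
      by simp
    then show ?thesis unfolding 1 cosh_cos_integral_eq_Gamma[OF x] by simp
  qed
  then have eq: "complex_of_real (\<Sum>m\<in>{- int M..int M}. (if even m then 1 else -1) * cosh_cos_integral x (pi * of_int m / L) / (2 * L)) =
      ?c * (\<Sum>m\<in>{- int M..int M}. Gamma_summand \<epsilon> m (of_real x))" for M
    by (simp only: of_real_sum sum_distrib_left)
  have "(\<lambda>M. ?c * (\<Sum>m\<in>{- int M..int M}. Gamma_summand \<epsilon> m (of_real x))) \<longlonglongrightarrow>
      of_real (\<Sum>n. cosh_powr x ((2 * real n + 1) * L))"
    unfolding eq[symmetric] by (intro tendsto_of_real poisson_cosh_powr x L)
  moreover have "(\<lambda>M. ?c * (\<Sum>m\<in>{- int M..int M}. Gamma_summand \<epsilon> m (of_real x))) \<longlonglongrightarrow>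
      ?c * (\<Sum>\<^sub>\<infinity>m. Gamma_summand \<epsilon> m (of_real x))"
    by (intro tendsto_intros summable_on_int_symmetric_tendsto Gamma_summand_summable \<epsilon> nin)
  ultimately have "?c * (\<Sum>\<^sub>\<infinity>m. Gamma_summand \<epsilon> m (of_real x)) = of_real (\<Sum>n. cosh_powr x ((2 * real n + 1) * L))"
    by (rule LIMSEQ_unique[rotated])
  also have "\<dots> = (\<Sum>n. cosh_term L (of_real x) n)"
  proof -
    have "summable (\<lambda>n. norm (cosh_powr x ((2 * real n + 1) * L)))"
      using norm_cosh_term_le[OF L x, of "of_real x"] unfolding cosh_term_of_real
      by (intro summable_comparison_test'[OF geometric_exp_summable[OF L x]]) auto
    then show ?thesis
      unfolding cosh_term_of_real by (rule suminf_of_real[OF summable_norm_cancel])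
  qed
  finally have "?c * (\<Sum>\<^sub>\<infinity>m. Gamma_summand \<epsilon> m (of_real x)) = (\<Sum>n. cosh_term L (of_real x) n)" .
  moreover have "Gamma_formula D \<epsilon> (of_real x) = of_int (quad_disc D) powr (of_real x / 2) *
      (?c * (\<Sum>\<^sub>\<infinity>m. Gamma_summand \<epsilon> m (of_real x)))"
    by (simp add: Gamma_formula_def L_def)
  ultimately show ?thesis by (simp only: L_def)
qed

text \<open>Identity theorem: both sides are holomorphic on the right half-plane, which is
  connected, and agree on the positive reals, which accumulate at 1.\<close>

lemma Gamma_formula_eq_series:
  assumes D: "D > 1" and \<epsilon>: "\<epsilon> > 1" and s: "Re s > 0"
  shows "Gamma_formula D \<epsilon> s = of_int (quad_disc D) powr (s / 2) * (\<Sum>n. cosh_term (ln \<epsilon>) s n)"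
proof -
  define S where "S = {s. Re s > 0}"
  have L: "ln \<epsilon> > 0" using \<epsilon> by simp
  let ?f = "\<lambda>s. Gamma_formula D \<epsilon> s - (8 * of_real (ln \<epsilon>) * Gamma_prefactor D \<epsilon> s) * (\<Sum>n. cosh_term (ln \<epsilon>) s n)"
  have pre: "8 * of_real (ln \<epsilon>) * Gamma_prefactor D \<epsilon> s = of_int (quad_disc D) powr (s / 2)" for s
    using L by (simp add: Gamma_prefactor_def)
  have "Gamma_formula D \<epsilon> analytic_on S"
    unfolding analytic_on_analytic_at[of _ S] using pole_set_Re
    by (intro ballI Gamma_formula_analytic D \<epsilon>) (force simp: S_def)
  then have holG: "Gamma_formula D \<epsilon> holomorphic_on S" by (rule analytic_imp_holomorphic)
  have holP: "Gamma_prefactor D \<epsilon> holomorphic_on S"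
    by (rule analytic_imp_holomorphic[OF Gamma_prefactor_props(1)[OF D \<epsilon>]])
  have hol: "?f holomorphic_on S"
    using cosh_term_suminf_holomorphic[OF L] unfolding S_def[symmetric]
    by (intro holomorphic_intros holG holP)
  have zero: "?f z = 0" if "z \<in> complex_of_real ` {0<..}" for z
  proof -
    from that obtain x where x: "x > 0" "z = of_real x" by (elim imageE) simp
    show ?thesis unfolding pre x(2) Gamma_formula_real[OF \<epsilon> x(1)] by simp
  qed
  have "?f s = 0"
  proof (rule analytic_continuation[OF hol])
    show "open S" unfolding S_def by (rule open_halfspace_Re_gt)
    show "connected S" unfolding S_def by (intro convex_connected convex_halfspace_Re_gt)
    show "complex_of_real ` {0<..} \<subseteq> S" by (auto simp: S_def)
    show "1 \<in> S" "s \<in> S" using s by (auto simp: S_def)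
    show "1 islimpt complex_of_real ` {0<..}"
      unfolding islimpt_approachable
    proof (intro allI impI)
      fix e :: real assume e: "e > 0"
      show "\<exists>x'\<in>complex_of_real ` {0<..}. x' \<noteq> 1 \<and> dist x' 1 < e"
      proof (rule bexI[of _ "complex_of_real (1 + e / 2)"])
        show "complex_of_real (1 + e / 2) \<in> complex_of_real ` {0<..}" by (rule imageI) (use e in simp)
      qed (use e in \<open>auto simp: dist_norm norm_divide\<close>)
    qed
  qed (rule zero)
  then show ?thesis unfolding pre by simp
qed

lemma Z_odd_term_has_sum:
  assumes D: "D > 1" "squarefree D" and \<epsilon>: "\<epsilon> \<in> quad_field D" "\<epsilon> > 1" "quad_norm D \<epsilon> = -1"
    and s: "Re s > 0"
  shows "(Z_odd_term D \<epsilon> s has_sum Gamma_formula D \<epsilon> s) {1..}"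
proof -
  have L: "ln \<epsilon> > 0" using \<epsilon> by simp
  have q: "real_of_int (quad_disc D) > 0" using D by (simp add: quad_disc_def)
  \<comment> \<open>The value of \<open>F_D\<close> is positive, so its complex power uses the real
    logarithm, and dividing by sqrt(q) contributes q^(s/2).\<close>
  have term_eq: "Z_odd_term D \<epsilon> s (Suc n) = of_int (quad_disc D) powr (s / 2) * cosh_term (ln \<epsilon>) s n" for n
  proof -
    define t where "t = 2 * cosh ((2 * real n + 1) * ln \<epsilon>)"
    define r where "r = sqrt (real_of_int (quad_disc D))"
    have t: "t > 0" "r > 0" using q by (simp_all add: t_def r_def)
    have "ln (t / r) = ln t - ln (real_of_int (quad_disc D)) / 2"
      using t q by (simp add: ln_div r_def ln_sqrt)
    moreover have "Z_odd_term D \<epsilon> s (Suc n) = exp (- s * of_real (ln (t / r)))"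
      unfolding Z_odd_term_def F_D_odd_eq_cosh[OF D \<epsilon>] t_def[symmetric] r_def[symmetric]
      using t Ln_of_real[of "t / r"] by (simp add: powr_def del: of_real_divide)
    moreover have "complex_of_int (quad_disc D) powr (s / 2) = exp (s / 2 * of_real (ln (real_of_int (quad_disc D))))"
      using q Ln_of_real[OF q] by (simp add: powr_def)
    moreover have "exp (- s * (a - b / 2)) = exp (s / 2 * b) * exp (- s * a)" for a b :: complex
      by (simp add: algebra_simps flip: exp_add)
    ultimately show ?thesis
      by (simp only: cosh_term_def flip: t_def) (simp only: of_real_diff of_real_divide of_real_numeral)
  qed
  have "((\<lambda>n. of_int (quad_disc D) powr (s / 2) * cosh_term (ln \<epsilon>) s n) has_sum Gamma_formula D \<epsilon> s) UNIV"
    unfolding Gamma_formula_eq_series[OF D(1) \<epsilon>(2) s]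
    by (intro has_sum_cmult_right cosh_term_has_sum L s)
  then have "((Z_odd_term D \<epsilon> s \<circ> Suc) has_sum Gamma_formula D \<epsilon> s) UNIV"
    by (simp add: o_def term_eq)
  then have "(Z_odd_term D \<epsilon> s has_sum Gamma_formula D \<epsilon> s) (range Suc)"
    by (subst has_sum_reindex) auto
  moreover have "range Suc = {1..}" by (auto simp: image_iff Suc_le_eq gr0_conv_Suc)
  ultimately show ?thesis by simp
qed

theorem theorem8:
  fixes D :: int and \<epsilon> :: real
  assumes "D > 1" and "squarefree D"
    and "fundamental_unit D \<epsilon>" and "quad_norm D \<epsilon> = -1"
  shows "(\<forall>s. Re s > 0 \<longrightarrow> Z_odd_term D \<epsilon> s summable_on {1..}) \<and>
    (\<exists>Z. Z meromorphic_on UNIV \<and>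
      (\<forall>s. Re s > 0 \<longrightarrow> Z s = Z_odd D \<epsilon> s) \<and>
      (\<forall>s. (\<forall>m. \<not> is_pole (Gamma_summand \<epsilon> m) s) \<longrightarrow>
             (\<lambda>m. Gamma_summand \<epsilon> m s) summable_on UNIV \<and> Z s = Gamma_formula D \<epsilon> s) \<and>
      Z holomorphic_on - pole_set \<epsilon> \<and>
      (\<forall>s \<in> pole_set \<epsilon>. is_pole Z s \<and> zorder Z s = -1))"
proof -
  have \<epsilon>: "\<epsilon> \<in> quad_field D" "\<epsilon> > 1"
    using assms(3) by (auto simp: fundamental_unit_def quad_units_def quad_int_def)
  note sum = Z_odd_term_has_sum[OF assms(1,2) \<epsilon> assms(4)]
  \<comment> \<open>The continuation is the formula itself, so its agreement with the formula is
    immediate.\<close>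
  let ?Z = "Gamma_formula D \<epsilon>"
  have pole: "is_pole ?Z s \<and> zorder ?Z s = -1 \<and> ?Z meromorphic_on {s}" if "s \<in> pole_set \<epsilon>" for s
  proof -
    from that obtain k m where s: "s = - 2 * of_nat k + of_real pi * \<i> * of_int m / of_real (ln \<epsilon>)"
      by (auto simp: pole_set_def)
    obtain g where "g analytic_on {s}" "g s \<noteq> 0" "eventually (\<lambda>w. ?Z w = g w / (w - s)) (at s)"
      using Gamma_formula_pole[OF assms(1) \<epsilon>(2) s] by blast
    then show ?thesis using simple_poleI by blast
  qed
  have an: "?Z analytic_on {s}" if "s \<notin> pole_set \<epsilon>" for s
    using Gamma_formula_analytic[OF assms(1) \<epsilon>(2) that] .
  \<comment> \<open>Every point of \<open>pole_set\<close> is a pole of some summand, so a point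
    where no summand has a pole lies outside it.\<close>
  have regular: "s \<notin> pole_set \<epsilon>" if "\<forall>m. \<not> is_pole (Gamma_summand \<epsilon> m) s" for s
  proof
    assume "s \<in> pole_set \<epsilon>"
    then obtain k m where "s = - 2 * of_nat k + of_real pi * \<i> * of_int m / of_real (ln \<epsilon>)"
      by (auto simp: pole_set_def)
    with that is_pole_Gamma_summand[OF \<epsilon>(2)] show False by metis
  qed
  show ?thesis
  proof (intro conjI exI[of _ ?Z] allI impI ballI)
    show "?Z meromorphic_on UNIV"
      unfolding meromorphic_on_meromorphic_at[of _ UNIV]
    proof
      show "?Z meromorphic_on {s}" for s
        using pole[of s] analytic_on_imp_meromorphic_on[OF an[of s]] by blast
    qed
    show "?Z holomorphic_on - pole_set \<epsilon>"
      by (rule analytic_imp_holomorphic) (use an analytic_on_analytic_at[of ?Z "- pole_set \<epsilon>"] in blast)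
    show "?Z s = Z_odd D \<epsilon> s" if "Re s > 0" for s
      using infsumI[OF sum[OF that]] by (simp add: Z_odd_def)
    show "Z_odd_term D \<epsilon> s summable_on {1..}" if "Re s > 0" for s
      using sum[OF that] by (rule has_sum_imp_summable)
    show "(\<lambda>m. Gamma_summand \<epsilon> m s) summable_on UNIV"
      if "\<forall>m. \<not> is_pole (Gamma_summand \<epsilon> m) s" for s
      using Gamma_summand_summable[OF \<epsilon>(2) regular[OF that]] .
  qed (simp_all add: pole)
qed

end
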